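(* In the measurement model $\mathbf{y}=\mathbf{X}\boldsymbol{\beta}+\mathbf{z}$ with the $N\times p$ extended discrete Fourier transform design matrix $\mathbf{X}$, suppose $N=p^{1-\gamma}$ with $\gamma\in[0,1)$. Consider testing $H_0:\boldsymbol{\beta}=\mathbf{0}$ against $H_1$: $\boldsymbol{\beta}\neq\mathbf{0}$ and $\boldsymbol{\beta}$ is sparse. Under the alternative, assume that $\boldsymbol{\beta}$ has $s=p^{1-\alpha}$ nonzero entries with $\frac{1+\gamma}{2}<\alpha<1$, and that $(\boldsymbol{\tau},\tilde{\boldsymbol{\beta}})\in\Gamma(p,N,s,r)$ with parameter $r$. If $r<\rho^*_\gamma(\alpha)$, then all sequences of hypothesis tests are asymptotically powerless, that is, $$\lim_{N\to\infty}\Bigl(\mathbb{P}_0(H_0\text{ is rejected})+\max_{(\boldsymbol{\tau},\tilde{\boldsymbol{\beta}})\in\Gamma(p,N,s,r)}\mathbb{P}_{(\boldsymbol{\tau},\tilde{\boldsymbol{\beta}})}(H_0\text{ is accepted})\Bigr)=1.$$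
   Context: Model. $\mathbf{y}=\mathbf{X}\boldsymbol{\beta}+\mathbf{z}\in\mathbb{C}^N$, where $\mathbf{X}\in\mathbb{C}^{N\times p}$ has entries $X_{jk}=\frac{1}{\sqrt p}e^{-2\pi i(k-1)(j-1)/p}$ for $1\le j\le N$, $1\le k\le p$; $\boldsymbol{\beta}\in\mathbb{C}^p$ is an unknown coefficient vector; and $\mathbf{z}=(z_1,\dots,z_N)$ has i.i.d. standard complex normal entries, i.e. $z_t=z_{1t}+iz_{2t}$ with $z_{1t},z_{2t}$ independent real $\mathcal{N}(0,1/2)$ variables (the noise level is known and normalized to $\sigma=1$). Parametrization. Under the alternative, $\boldsymbol{\beta}$ has support $\{\tau_1,\dots,\tau_s\}$ with $1\le\tau_1<\cdots<\tau_s\le p$. Write $\boldsymbol{\tau}=(\tau_1,\dots,\tau_s)^T$ and $\tilde{\boldsymbol{\beta}}=(\tilde\beta_1,\dots,\tilde\beta_s)^T=(\beta_{\tau_1},\dots,\beta_{\tau_s})^T$. $\mathbb{P}_{(\boldsymbol{\tau},\tilde{\boldsymbol{\beta}})}$ denotes the distribution of $\mathbf{y}$ under this $\boldsymbol{\beta}$, and $\mathbb{P}_0$ the distribution of $\mathbf{y}$ when $\boldsymbol{\beta}=\mathbf{0}$. Minimum separation. $\Delta(\boldsymbol{\tau})=\frac1p\min\{|\tau_{l+1}-\tau_l|: l=1,\dots,s\}$ with the convention $\tau_{s+1}:=\tau_1+p$. Parameter space. $\Gamma(p,N,s,r)$ is the set of all $(\boldsymbol{\tau},\tilde{\boldsymbol{\beta}})$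 such that $|\tilde\beta_1|=\cdots=|\tilde\beta_s|=A=\sqrt{\frac{r\,p\log p}{N}}$ and $\Delta(\boldsymbol{\tau})\ge\frac{\log^2N}{N}$, where $\log^2 N=(\log N)^2$. Detection boundary. $$\rho^*_\gamma(\alpha)=\begin{cases}\bigl(\sqrt{1-\gamma}-\sqrt{1-\alpha}\bigr)^2,&\alpha\in\bigl[\frac34+\frac\gamma4,1\bigr),\\ \alpha-\frac12-\frac\gamma2,&\alpha\in\bigl[\frac{1+\gamma}{2},\frac34+\frac\gamma4\bigr).\end{cases}$$ Here $\gamma$, $\alpha$ and $r$ are fixed, and the hypothesis tests decide between accepting and rejecting $H_0$ on the basis of $\mathbf{y}$.
   Formalization: The limit 1 for all tests is false literally (a test that swaps accept and reject can have risk tending to 2); proved instead: liminf of the risk is at least 1 for every sequence of tests, and the smallest risk over all tests tends to 1. N and s are the given powers of p up to rounding. *)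

theory Defs
  imports "HOL-Probability.Probability"
begin

text \<open>
  Vectors and matrices are functions on 1-based index sets:
  an observation in \<open>\<complex>\<^sup>N\<close> is an element of the product space over \<open>{1..N}\<close>.
  Only the entries of a coefficient vector with index in \<open>{1..p}\<close> matter.
\<close>

definition dft_design :: "nat \<Rightarrow> nat \<Rightarrow> nat \<Rightarrow> complex" where
  "dft_design p j k =
     exp (- 2 * of_real pi * \<i> * (of_nat k - 1) * (of_nat j - 1) / of_nat p)
       / of_real (sqrt (real p))"

text \<open>\<^const>\<open>normal_density\<close> takes the standard deviation; the variance here is \<open>1/2\<close>.\<close>

definition normal_half :: "real measure" where
  "normal_half = density lborel (\<lambda>x. ennreal (normal_density 0 (sqrt (1/2)) x))"

definition std_complex_normal :: "complex measure" where
  "std_complex_normal = distr (normal_half \<Otimes>\<^sub>M normal_half) borel (\<lambda>(u, v). Complex u v)"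

definition obs_space :: "nat \<Rightarrow> (nat \<Rightarrow> complex) measure" where
  "obs_space N = Pi\<^sub>M {1..N} (\<lambda>_. borel)"

definition noise :: "nat \<Rightarrow> (nat \<Rightarrow> complex) measure" where
  "noise N = Pi\<^sub>M {1..N} (\<lambda>_. std_complex_normal)"

definition obs_law :: "nat \<Rightarrow> nat \<Rightarrow> (nat \<Rightarrow> complex) \<Rightarrow> (nat \<Rightarrow> complex) measure" where
  "obs_law p N \<beta> = distr (noise N) (obs_space N)
     (\<lambda>z. \<lambda>j\<in>{1..N}. (\<Sum>k = 1..p. dft_design p j k * \<beta> k) + z j)"

text \<open>The coefficient vector with value \<open>b l\<close> at position \<open>\<tau> l\<close> and \<open>0\<close> elsewhere
  (for \<open>\<tau>\<close> injective on \<open>{1..s}\<close>).\<close>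

definition coeff_vec :: "nat \<Rightarrow> (nat \<Rightarrow> nat) \<Rightarrow> (nat \<Rightarrow> complex) \<Rightarrow> nat \<Rightarrow> complex" where
  "coeff_vec s \<tau> b k = (\<Sum>l\<in>{l\<in>{1..s}. \<tau> l = k}. b l)"

text \<open>Cyclic minimum separation, with \<open>\<tau> (s + 1)\<close> read as \<open>\<tau> 1 + p\<close>.  Meaningful for \<open>s \<ge> 1\<close>.\<close>

definition min_separation :: "nat \<Rightarrow> nat \<Rightarrow> (nat \<Rightarrow> nat) \<Rightarrow> real" where
  "min_separation p s \<tau> =
     Min ((\<lambda>l. \<bar>real (if l = s then \<tau> 1 + p else \<tau> (l + 1)) - real (\<tau> l)\<bar>) ` {1..s}) / real p"

definition param_space ::
    "nat \<Rightarrow> nat \<Rightarrow> nat \<Rightarrow> real \<Rightarrow> ((nat \<Rightarrow> nat) \<times> (nat \<Rightarrow> complex)) set" where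
  "param_space p N s r = {(\<tau>, b).
     \<tau> \<in> {1..s} \<rightarrow>\<^sub>E {1..p} \<and> strict_mono_on {1..s} \<tau> \<and> b \<in> {1..s} \<rightarrow>\<^sub>E UNIV \<and>
     (\<forall>l\<in>{1..s}. cmod (b l) = sqrt (r * real p * ln (real p) / real N)) \<and>
     min_separation p s \<tau> \<ge> (ln (real N))\<^sup>2 / real N}"

text \<open>A test is given by its (measurable) rejection region \<open>R\<close>.  The maximum over the parameter
  space is written as a supremum.  Note that a single test can have risk well above 1: exchange
  acceptance and rejection in a test tuned to one point of the parameter space.  Asymptotic
  powerlessness of all tests therefore means that the risk of every sequence of tests has limit
  inferior at least 1, and the limit 1 is that of the smallest risk over all tests.\<close>

definition worst_case_risk :: "nat \<Rightarrow> nat \<Rightarrow> nat \<Rightarrow> real \<Rightarrow> (nat \<Rightarrow> complex) set \<Rightarrow> real" where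
  "worst_case_risk p N s r R =
     measure (obs_law p N (\<lambda>_. 0)) R +
     (SUP (\<tau>, b)\<in>param_space p N s r.
        measure (obs_law p N (coeff_vec s \<tau> b)) (space (obs_space N) - R))"

text \<open>The boundary \<open>\<rho>\<^sup>*\<close>; relevant for \<open>(1 + \<gamma>) / 2 \<le> \<alpha> < 1\<close> only.\<close>

definition detection_boundary :: "real \<Rightarrow> real \<Rightarrow> real" where
  "detection_boundary \<gamma> \<alpha> =
     (if 3/4 + \<gamma>/4 \<le> \<alpha> then (sqrt (1 - \<gamma>) - sqrt (1 - \<alpha>))\<^sup>2
      else \<alpha> - 1/2 - \<gamma>/2)"

end

theory Submission
  imports Defs "HOL-Real_Asymp.Real_Asymp"
begin

text \<open>
  The minimax risk is bounded below by the Bayes risk for a prior on the parameter space, and for a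
  suitable prior the likelihood ratio, truncated to typical observations, tends to \<open>1\<close> in
  \<open>L\<^sup>2(P\<^sub>0)\<close>.  Then no test separates the mixture from \<open>P\<^sub>0\<close>
  (\<open>testing_lower_bound\<close>).  That the smallest risk does not exceed \<open>1\<close> is shown by the test
  that never rejects.

  Write \<open>N = p\<^bsup>1-\<gamma>\<^esup>\<close>.  The columns of the design are not orthogonal, but by the Dirichlet
  kernel bound two columns at distance \<open>d \<le> p / 2\<close> have inner product at most \<open>1 / (2 d)\<close>, whereas each has
  squared length \<open>N / p\<close>.  The prior exploits this: the first half of \<open>{1..p}\<close> contains \<open>s\<close>
  well separated blocks, in each block one of \<open>m\<close> positions with spacing
  \<open>g \<approx> p (log p)\<^sup>2 / N\<close> is chosen uniformly and independently, and all coefficients equal \<open>A\<close>.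
  The spacing enforces the required separation.  The total correlation \<open>\<eta>\<close> between different
  blocks is of order at most \<open>(s / m) log s\<close>, where \<open>s / m \<approx> s\<^sup>2 / N\<close> up to logarithms, and
  \<open>\<alpha> > (1 + \<gamma>) / 2\<close> says exactly that \<open>s\<^sup>2 / N\<close> is a negative power of \<open>p\<close>.  So the blocks
  behave as if they were independent, each with \<open>m\<close> nearly orthogonal
  candidates.

  Let \<open>a = sqrt (1 - \<gamma>)\<close>, \<open>b = sqrt (1 - \<alpha>)\<close> and \<open>q = sqrt r\<close>.  Each candidate column
  \<open>u\<close> has energy \<open>q\<^sup>2 log p\<close>.  The likelihood ratio of a configuration is kept only where
  \<open>\<langle>u, y\<rangle> \<le> T = q a log p\<close> for each of its columns \<open>u\<close>; the largest of about \<open>N\<close> independent noise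
  correlations has this order.  The truncation removes mass of order at most
  \<open>s p powr (- (a - q)\<^sup>2)\<close>, which vanishes for \<open>b < a - q\<close>.  In the second moment every block in
  which two independent configurations agree contributes a factor \<open>p powr \<kappa>\<close>, with
  \<open>\<kappa> = 2 q\<^sup>2\<close> if \<open>2 q \<le> a\<close> and \<open>\<kappa> = a\<^sup>2 - 2 (a - q)\<^sup>2\<close> otherwise.  Such agreement has
  probability \<open>1 / m\<close> per block, so the second moment tends to \<open>1\<close> if
  \<open>(s / m) p powr \<kappa>\<close> vanishes, that is if \<open>2 b\<^sup>2 - a\<^sup>2 + \<kappa> < 0\<close>.  Both conditions hold
  below the detection boundary (\<open>detection_boundary_exponents\<close>).

  All probabilities of truncation events are replaced by exponential (Chernoff) bounds.  For Gaussian
  noise, everything then reduces to the identity \<open>E exp (2 \<langle>a, z\<rangle>) = exp \<langle>a, a\<rangle>\<close>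
  (\<open>integral_exp_vec_inner\<close>), in which the correlations between the
  \<open>\<langle>u, z\<rangle>\<close> enter only through the Gram matrix of the columns.
\<close>

section \<open>Translated Gaussian noise\<close>

lemma prob_space_normal_half: "prob_space normal_half"
  unfolding normal_half_def by (rule prob_space_normal_density) simp

lemma sets_normal_half [measurable_cong, simp]: "sets normal_half = sets borel"
  by (simp add: normal_half_def)

lemma measurable_Complex_pair [measurable]:
  "(\<lambda>(u, v). Complex u v) \<in> borel_measurable (borel \<Otimes>\<^sub>M borel)"
  by (simp add: borel_measurable_complex_iff split_beta')

lemma measurable_Complex_normal_half [measurable]:
  "(\<lambda>(u, v). Complex u v) \<in> borel_measurable (normal_half \<Otimes>\<^sub>M normal_half)"
  using measurable_Complex_pair
    measurable_cong_sets[OF sets_pair_measure_cong[OF sets_normal_half sets_normal_half] refl] by blast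

lemma nn_integral_normal_half_shift:
  assumes [measurable]: "f \<in> borel_measurable borel"
  shows "(\<integral>\<^sup>+x. f (x + c) \<partial>normal_half)
       = (\<integral>\<^sup>+x. ennreal (exp (2 * c * x - c\<^sup>2)) * f x \<partial>normal_half)"
proof -
  have "(\<integral>\<^sup>+x. f (x + c) \<partial>normal_half)
      = (\<integral>\<^sup>+x. ennreal (normal_density 0 (sqrt (1/2)) x) * f (x + c) \<partial>lborel)"
    by (simp add: normal_half_def nn_integral_density)
  also have "\<dots> = (\<integral>\<^sup>+x. ennreal (normal_density 0 (sqrt (1/2)) (x - c)) * f x \<partial>lborel)"
    by (subst nn_integral_real_affine[where c=1 and t="-c"]) simp_all
  also have "\<dots> = (\<integral>\<^sup>+x. ennreal (normal_density 0 (sqrt (1/2)) x) *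
      (ennreal (exp (2 * c * x - c\<^sup>2)) * f x) \<partial>lborel)"
  proof (intro nn_integral_cong)
    fix x
    have "normal_density 0 (sqrt (1/2)) (x - c)
        = normal_density 0 (sqrt (1/2)) x * exp (2 * c * x - c\<^sup>2)"
      by (simp add: normal_density_def real_sqrt_divide power_divide mult_exp_exp power2_eq_square
        algebra_simps)
    then show "ennreal (normal_density 0 (sqrt (1/2)) (x - c)) * f x
      = ennreal (normal_density 0 (sqrt (1/2)) x) * (ennreal (exp (2 * c * x - c\<^sup>2)) * f x)"
      by (simp add: ennreal_mult mult.assoc)
  qed
  also have "\<dots> = (\<integral>\<^sup>+x. ennreal (exp (2 * c * x - c\<^sup>2)) * f x \<partial>normal_half)"
    by (simp add: normal_half_def nn_integral_density)
  finally show ?thesis .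
qed

lemma prob_space_std_complex_normal: "prob_space std_complex_normal"
proof -
  interpret prob_space normal_half by (rule prob_space_normal_half)
  interpret pair_prob_space normal_half normal_half ..
  show ?thesis
    unfolding std_complex_normal_def by (rule prob_space_distr) measurable
qed

lemma sets_std_complex_normal [measurable_cong, simp]: "sets std_complex_normal = sets borel"
  by (simp add: std_complex_normal_def)

lemma space_std_complex_normal [simp]: "space std_complex_normal = UNIV"
  by (simp add: std_complex_normal_def)

text \<open>
  The change of measure for a translated complex normal variable.  The real scalar product
  \<open>m \<bullet> z\<close> on \<open>\<complex>\<close> is the real part of \<open>cnj m * z\<close>; there is no factor \<open>1/2\<close> in the exponent
  because real and imaginary part have variance \<open>1/2\<close>.
\<close>

lemma nn_integral_std_complex_normal_shift:
  assumes [measurable]: "f \<in> borel_measurable borel"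
  shows "(\<integral>\<^sup>+z. f (m + z) \<partial>std_complex_normal)
       = (\<integral>\<^sup>+z. ennreal (exp (2 * (m \<bullet> z) - m \<bullet> m)) * f z \<partial>std_complex_normal)"
proof -
  interpret N: prob_space normal_half by (rule prob_space_normal_half)
  interpret pair_prob_space normal_half normal_half ..
  define a b where "a = Re m" and "b = Im m"
  have m: "m = Complex a b" by (simp add: a_def b_def)
  have [measurable]: "(\<lambda>x. Complex (g x) (h x)) \<in> borel_measurable M"
    if "g \<in> borel_measurable M" "h \<in> borel_measurable M" for g h and M :: "'z measure"
    using that by (simp add: borel_measurable_complex_iff)
  have iter: "(\<integral>\<^sup>+z. g z \<partial>std_complex_normal)
      = (\<integral>\<^sup>+u. \<integral>\<^sup>+v. g (Complex u v) \<partial>normal_half \<partial>normal_half)"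
    if [measurable]: "g \<in> borel_measurable borel" for g
    unfolding std_complex_normal_def
    by (simp add: nn_integral_distr N.nn_integral_fst[symmetric] split_beta')
  have add: "m + Complex u v = Complex (u + a) (v + b)" for u v
    by (simp add: m complex_eq_iff)
  have "(\<integral>\<^sup>+z. f (m + z) \<partial>std_complex_normal)
      = (\<integral>\<^sup>+u. \<integral>\<^sup>+v. f (Complex (u + a) (v + b)) \<partial>normal_half \<partial>normal_half)"
    by (subst iter) (simp_all add: add)
  also have "\<dots> = (\<integral>\<^sup>+u. \<integral>\<^sup>+v. ennreal (exp (2 * b * v - b\<^sup>2)) * f (Complex (u + a) v)
      \<partial>normal_half \<partial>normal_half)"
    by (intro nn_integral_cong nn_integral_normal_half_shift) measurable
  also have "\<dots> = (\<integral>\<^sup>+u. ennreal (exp (2 * a * u - a\<^sup>2)) *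
      (\<integral>\<^sup>+v. ennreal (exp (2 * b * v - b\<^sup>2)) * f (Complex u v) \<partial>normal_half) \<partial>normal_half)"
    by (rule nn_integral_normal_half_shift) measurable
  also have "\<dots> = (\<integral>\<^sup>+u. \<integral>\<^sup>+v. ennreal (exp (2 * (m \<bullet> Complex u v) - m \<bullet> m)) * f (Complex u v)
      \<partial>normal_half \<partial>normal_half)"
  proof (intro nn_integral_cong)
    fix u
    have "exp (2 * (m \<bullet> Complex u v) - m \<bullet> m)
        = exp (2 * a * u - a\<^sup>2) * exp (2 * b * v - b\<^sup>2)" for v
      by (simp add: m inner_complex_def mult_exp_exp power2_eq_square algebra_simps)
    then have "ennreal (exp (2 * a * u - a\<^sup>2)) * (ennreal (exp (2 * b * v - b\<^sup>2)) * f (Complex u v))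
       = ennreal (exp (2 * (m \<bullet> Complex u v) - m \<bullet> m)) * f (Complex u v)" for v
      by (simp add: ennreal_mult mult.assoc)
    then show "ennreal (exp (2 * a * u - a\<^sup>2)) *
      (\<integral>\<^sup>+v. ennreal (exp (2 * b * v - b\<^sup>2)) * f (Complex u v) \<partial>normal_half)
      = (\<integral>\<^sup>+v. ennreal (exp (2 * (m \<bullet> Complex u v) - m \<bullet> m)) * f (Complex u v) \<partial>normal_half)"
      by (subst nn_integral_cmult[symmetric]) simp_all
  qed
  also have "\<dots> = (\<integral>\<^sup>+z. ennreal (exp (2 * (m \<bullet> z) - m \<bullet> m)) * f z \<partial>std_complex_normal)"
    by (subst iter) simp_all
  finally show ?thesis .
qed

definition vec_inner :: "nat \<Rightarrow> (nat \<Rightarrow> complex) \<Rightarrow> (nat \<Rightarrow> complex) \<Rightarrow> real" where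
  "vec_inner N a b = (\<Sum>j\<in>{1..N}. a j \<bullet> b j)"

lemma prob_space_noise: "prob_space (noise N)"
  unfolding noise_def by (rule prob_space_PiM) (rule prob_space_std_complex_normal)

lemma sets_noise [measurable_cong, simp]: "sets (noise N) = sets (obs_space N)"
  unfolding noise_def obs_space_def by (rule sets_PiM_cong) simp_all

lemma space_noise [simp]: "space (noise N) = space (obs_space N)"
  by (rule sets_eq_imp_space_eq) simp

lemma measurable_vec_inner [measurable]: "vec_inner N a \<in> borel_measurable (obs_space N)"
  unfolding vec_inner_def obs_space_def by measurable

text \<open>
  Each side is a product measure whose factors are the one-dimensional translated normal laws, by the
  preceding change of measure in every coordinate.
\<close>

lemma distr_noise_shift:
  "distr (noise N) (obs_space N) (\<lambda>z. \<lambda>j\<in>{1..N}. m j + z j)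
     = density (noise N) (\<lambda>z. ennreal (exp (2 * vec_inner N m z - vec_inner N m m)))"
  (is "?P = ?Q")
proof -
  define w where "w j z = ennreal (exp (2 * (m j \<bullet> z) - m j \<bullet> m j))" for j z
  have w [measurable]: "w j \<in> borel_measurable borel" for j
    unfolding w_def by measurable
  have shift: "(\<lambda>z. \<lambda>j\<in>{1..N}. m j + z j) \<in> measurable (noise N) (obs_space N)"
    unfolding obs_space_def noise_def by measurable
  interpret S: product_sigma_finite "\<lambda>_. std_complex_normal"
    using prob_space_std_complex_normal
    by (simp add: product_sigma_finite_def prob_space_imp_sigma_finite)
  have dens: "density std_complex_normal (w j) = distr std_complex_normal borel ((+) (m j))" for j
  proof (rule measure_eqI)
    fix A assume "A \<in> sets (density std_complex_normal (w j))"
    then have [measurable]: "A \<in> sets borel" by simp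
    have "emeasure (density std_complex_normal (w j)) A
        = (\<integral>\<^sup>+z. w j z * indicator A z \<partial>std_complex_normal)"
      by (simp add: emeasure_density)
    also have "\<dots> = (\<integral>\<^sup>+z. indicator A (m j + z) \<partial>std_complex_normal)"
      unfolding w_def by (rule nn_integral_std_complex_normal_shift[symmetric]) measurable
    also have "\<dots> = (\<integral>\<^sup>+z. indicator A z \<partial>distr std_complex_normal borel ((+) (m j)))"
      by (subst nn_integral_distr) simp_all
    finally show "emeasure (density std_complex_normal (w j)) A
        = emeasure (distr std_complex_normal borel ((+) (m j))) A"
      by simp
  qed simp
  interpret T: product_sigma_finite "\<lambda>j. density std_complex_normal (w j)"
    unfolding dens product_sigma_finite_def
    by (intro allI prob_space_imp_sigma_finite prob_space.prob_space_distr
        prob_space_std_complex_normal) simp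
  have setsT: "sets (Pi\<^sub>M {1..N} (\<lambda>j. density std_complex_normal (w j))) = sets (obs_space N)"
    unfolding obs_space_def by (rule sets_PiM_cong) simp_all
  have "?P = Pi\<^sub>M {1..N} (\<lambda>j. density std_complex_normal (w j))"
  proof (rule T.PiM_eqI)
    fix A assume "\<And>j. j \<in> {1..N} \<Longrightarrow> A j \<in> sets (density std_complex_normal (w j))"
    then have A: "\<And>j. j \<in> {1..N} \<Longrightarrow> A j \<in> sets borel" by simp
    have "emeasure ?P (Pi\<^sub>E {1..N} A)
        = emeasure (noise N) ((\<lambda>z. \<lambda>j\<in>{1..N}. m j + z j) -` Pi\<^sub>E {1..N} A \<inter> space (noise N))"
      using A by (subst emeasure_distr[OF shift]) (auto simp: obs_space_def intro!: sets_PiM_I_finite)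
    also have "(\<lambda>z. \<lambda>j\<in>{1..N}. m j + z j) -` Pi\<^sub>E {1..N} A \<inter> space (noise N)
        = Pi\<^sub>E {1..N} (\<lambda>j. (+) (m j) -` A j)"
      by (auto simp: obs_space_def space_PiM PiE_iff)
    also have "emeasure (noise N) \<dots> = (\<Prod>j\<in>{1..N}. emeasure std_complex_normal ((+) (m j) -` A j))"
      unfolding noise_def using A
      by (subst S.emeasure_PiM) (auto intro!: measurable_sets_borel[of _ borel])
    also have "\<dots> = (\<Prod>j\<in>{1..N}. emeasure (density std_complex_normal (w j)) (A j))"
      unfolding dens using A by (intro prod.cong refl) (simp add: emeasure_distr)
    finally show "emeasure ?P (Pi\<^sub>E {1..N} A)
        = (\<Prod>j\<in>{1..N}. emeasure (density std_complex_normal (w j)) (A j))" .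
  qed (simp, simp only: setsT sets_distr)
  also have "\<dots> = ?Q"
  proof (rule T.PiM_eqI[symmetric])
    fix A assume "\<And>j. j \<in> {1..N} \<Longrightarrow> A j \<in> sets (density std_complex_normal (w j))"
    then have A: "\<And>j. j \<in> {1..N} \<Longrightarrow> A j \<in> sets borel" by simp
    then have "Pi\<^sub>E {1..N} A \<in> sets (noise N)"
      by (auto simp: obs_space_def intro!: sets_PiM_I_finite)
    then have "emeasure ?Q (Pi\<^sub>E {1..N} A)
        = (\<integral>\<^sup>+z. ennreal (exp (2 * vec_inner N m z - vec_inner N m m)) * indicator (Pi\<^sub>E {1..N} A) z
            \<partial>noise N)"
      by (subst emeasure_density) simp_all
    also have "\<dots> = (\<integral>\<^sup>+z. (\<Prod>j\<in>{1..N}. w j (z j) * indicator (A j) (z j)) \<partial>noise N)"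
    proof (rule nn_integral_cong)
      fix z assume "z \<in> space (noise N)"
      then have z: "z \<in> extensional {1..N}" by (auto simp: obs_space_def space_PiM PiE_iff)
      have "indicator (Pi\<^sub>E {1..N} A) z = (\<Prod>j\<in>{1..N}. indicator (A j) (z j) :: ennreal)"
        using z by (auto simp: indicator_def PiE_iff prod.neutral split: if_splits)
      moreover have "ennreal (exp (2 * vec_inner N m z - vec_inner N m m))
          = (\<Prod>j\<in>{1..N}. w j (z j))"
        by (simp add: w_def vec_inner_def prod_ennreal exp_sum[symmetric] sum_distrib_left
            sum_subtractf)
      ultimately show "ennreal (exp (2 * vec_inner N m z - vec_inner N m m))
            * indicator (Pi\<^sub>E {1..N} A) z
          = (\<Prod>j\<in>{1..N}. w j (z j) * indicator (A j) (z j))"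
        by (simp add: prod.distrib)
    qed
    also have "\<dots> = (\<Prod>j\<in>{1..N}. \<integral>\<^sup>+z. w j z * indicator (A j) z \<partial>std_complex_normal)"
      unfolding noise_def using A by (intro S.product_nn_integral_prod) auto
    also have "\<dots> = (\<Prod>j\<in>{1..N}. emeasure (density std_complex_normal (w j)) (A j))"
      using A by (intro prod.cong refl) (simp add: emeasure_density)
    finally show "emeasure ?Q (Pi\<^sub>E {1..N} A)
        = (\<Prod>j\<in>{1..N}. emeasure (density std_complex_normal (w j)) (A j))" .
  qed (simp, simp only: setsT sets_density sets_noise)
  finally show ?thesis .
qed

text \<open>
  The density of a translated noise vector has total mass \<open>1\<close>; this is the Gaussian moment
  generating function and the source of all moment bounds below.
\<close>

lemma
  shows integrable_exp_vec_inner: "integrable (noise N) (\<lambda>z. exp (2 * vec_inner N a z + k))"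
    and integral_exp_vec_inner:
      "(\<integral>z. exp (2 * vec_inner N a z + k) \<partial>noise N) = exp (vec_inner N a a + k)"
proof -
  have [measurable]: "(\<lambda>z. \<lambda>j\<in>{1..N}. a j + z j) \<in> measurable (noise N) (obs_space N)"
    unfolding obs_space_def noise_def by measurable
  define h where "h z = exp (2 * vec_inner N a z - vec_inner N a a)" for z
  have [measurable]: "h \<in> borel_measurable (noise N)"
    unfolding h_def by measurable
  have "prob_space (distr (noise N) (obs_space N) (\<lambda>z. \<lambda>j\<in>{1..N}. a j + z j))"
    by (rule prob_space.prob_space_distr[OF prob_space_noise]) measurable
  then have "prob_space (density (noise N) (\<lambda>z. ennreal (h z)))"
    by (simp only: distr_noise_shift h_def)
  then have "emeasure (density (noise N) (\<lambda>z. ennreal (h z))) (space (noise N)) = 1"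
    using prob_space.emeasure_space_1 by force
  then have "(\<integral>\<^sup>+z. ennreal (h z) * indicator (space (noise N)) z \<partial>noise N) = 1"
    by (subst (asm) emeasure_density) simp_all
  moreover have "(\<integral>\<^sup>+z. ennreal (h z) * indicator (space (noise N)) z \<partial>noise N)
      = (\<integral>\<^sup>+z. ennreal (h z) \<partial>noise N)"
    by (rule nn_integral_cong) simp
  ultimately have *: "(\<integral>\<^sup>+z. ennreal (h z) \<partial>noise N) = ennreal 1"
    by simp
  have h0: "h z \<ge> 0" for z by (simp add: h_def)
  have i: "integrable (noise N) h"
    using h0 * by (intro integrableI_nn_integral_finite[where x=1]) auto
  have l: "(\<integral>z. h z \<partial>noise N) = 1"
    using h0 * by (intro integral_eq_nn_integral[THEN trans]) auto
  have eq: "exp (2 * vec_inner N a z + k) = exp (vec_inner N a a + k) * h z" for z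
    by (simp add: h_def mult_exp_exp)
  show "integrable (noise N) (\<lambda>z. exp (2 * vec_inner N a z + k))"
    unfolding eq using i by simp
  show "(\<integral>z. exp (2 * vec_inner N a z + k) \<partial>noise N) = exp (vec_inner N a a + k)"
    unfolding eq using l by simp
qed

lemma vec_inner_commute: "vec_inner N a b = vec_inner N b a"
  by (simp add: vec_inner_def inner_commute)

lemma vec_inner_sum_left:
  "vec_inner N (\<lambda>j. \<Sum>i\<in>I. f i j) b = (\<Sum>i\<in>I. vec_inner N (f i) b)"
  unfolding vec_inner_def inner_sum_left by (rule sum.swap)

lemma vec_inner_sum_right:
  "vec_inner N a (\<lambda>j. \<Sum>i\<in>I. f i j) = (\<Sum>i\<in>I. vec_inner N a (f i))"
  by (simp add: vec_inner_commute[of N a] vec_inner_sum_left)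

lemma vec_inner_add_left: "vec_inner N (\<lambda>j. a j + b j) c = vec_inner N a c + vec_inner N b c"
  by (simp add: vec_inner_def inner_add_left sum.distrib)

lemma vec_inner_add_right: "vec_inner N c (\<lambda>j. a j + b j) = vec_inner N c a + vec_inner N c b"
  by (simp add: vec_inner_def inner_add_right sum.distrib)

lemma vec_inner_scaleR_left: "vec_inner N (\<lambda>j. r *\<^sub>R a j) c = r * vec_inner N a c"
  by (simp add: vec_inner_def sum_distrib_left)

lemma vec_inner_scaleR_right: "vec_inner N c (\<lambda>j. r *\<^sub>R a j) = r * vec_inner N c a"
  by (simp add: vec_inner_def sum_distrib_left)

lemmas vec_inner_simps = vec_inner_add_left vec_inner_add_right vec_inner_scaleR_left
  vec_inner_scaleR_right

section \<open>A lower bound for the risk of tests\<close>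

text \<open>
  In the application \<open>H\<close> is a truncated likelihood ratio and \<open>R\<close> a rejection region.  The sum of
  the error probabilities falls short of \<open>1\<close> by at most \<open>\<integral>|1 - H|\<close>, and the Cauchy-Schwarz inequality
  passes to \<open>\<integral>(1 - H)\<^sup>2\<close>, which involves the first two moments only.
\<close>

lemma (in prob_space) testing_lower_bound:
  fixes H :: "'a \<Rightarrow> real"
  assumes H: "integrable M H" "integrable M (\<lambda>x. (H x)\<^sup>2)"
    and lower: "expectation H \<ge> 1 - e1" and upper: "expectation (\<lambda>x. (H x)\<^sup>2) \<le> 1 + e2"
    and R: "R \<in> sets M"
  shows "1 - sqrt (2 * e1 + e2) \<le> prob R + expectation (\<lambda>x. indicator (space M - R) x * H x)"
proof -
  let ?I = "indicator (space M - R) :: 'a \<Rightarrow> real"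
  have [measurable]: "R \<in> sets M" by fact
  have iH: "integrable M (\<lambda>x. ?I x * H x)"
    by (rule Bochner_Integration.integrable_bound[OF H(1)]) (use H in \<open>auto split: split_indicator\<close>)
  have iI: "integrable M ?I"
    by (rule integrable_const_bound[where B=1]) (auto split: split_indicator)
  have iA: "integrable M (\<lambda>x. \<bar>1 - H x\<bar>)" using H by auto
  have iS: "integrable M (\<lambda>x. \<bar>1 - H x\<bar>\<^sup>2)" using H by (simp add: power2_diff)
  have "(expectation (\<lambda>x. \<bar>1 - H x\<bar>))\<^sup>2 \<le> expectation (\<lambda>x. \<bar>1 - H x\<bar>\<^sup>2)"
    using variance_positive[of "\<lambda>x. \<bar>1 - H x\<bar>"] variance_eq[OF iA iS] by simp
  also have "\<dots> = 1 - 2 * expectation H + expectation (\<lambda>x. (H x)\<^sup>2)"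
    using H by (simp add: power2_diff prob_space)
  also have "\<dots> \<le> 2 * e1 + e2" using lower upper by simp
  finally have le: "expectation (\<lambda>x. \<bar>1 - H x\<bar>) \<le> sqrt (2 * e1 + e2)"
    by (rule real_le_rsqrt)
  have "1 - prob R - expectation (\<lambda>x. ?I x * H x) = expectation (\<lambda>x. ?I x - ?I x * H x)"
    using iI iH by (simp add: prob_compl[OF R])
  also have "\<dots> \<le> expectation (\<lambda>x. \<bar>1 - H x\<bar>)"
    using iI iH iA by (intro integral_mono) (auto split: split_indicator)
  finally show ?thesis using le by simp
qed

section \<open>Mixtures over nearly orthogonal block families\<close>

lemma harm_le_one_plus_ln: "n \<ge> 1 \<Longrightarrow> harm n \<le> 1 + ln (real n)"
  using decseqD[OF decseq_harm_diff_ln, of 0 "n - 1"] by (simp add: harm_def)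

text \<open>
  Correlations decay like the inverse distance, so summing them over a row of the Gram matrix costs
  only a logarithm.
\<close>

lemma sum_inverse_dist_le_harm:
  fixes i n :: nat
  assumes "J \<subseteq> {..n}" "i \<le> n"
  shows "(\<Sum>j\<in>J - {i}. 1 / \<bar>real i - real j\<bar>) \<le> 2 * harm n"
proof -
  have "(\<Sum>j\<in>J - {i}. 1 / \<bar>real i - real j\<bar>)
      \<le> (\<Sum>j\<in>{..<i} \<union> {Suc i..n}. 1 / \<bar>real i - real j\<bar>)"
    using assms by (intro sum_mono2) auto
  also have "\<dots> = (\<Sum>j\<in>{..<i}. 1 / \<bar>real i - real j\<bar>) + (\<Sum>j\<in>{Suc i..n}. 1 / \<bar>real i - real j\<bar>)"
    by (intro sum.union_disjoint) auto
  also have "(\<Sum>j\<in>{..<i}. 1 / \<bar>real i - real j\<bar>) = (\<Sum>d\<in>{1..i}. 1 / real d)"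
    by (rule sum.reindex_bij_witness[of _ "\<lambda>d. i - d" "\<lambda>j. i - j"]) (auto simp: of_nat_diff)
  also have "\<dots> \<le> (\<Sum>d\<in>{1..n}. 1 / real d)"
    using assms by (intro sum_mono2) auto
  also have "(\<Sum>j\<in>{Suc i..n}. 1 / \<bar>real i - real j\<bar>) = (\<Sum>d\<in>{1..n - i}. 1 / real d)"
    by (rule sum.reindex_bij_witness[of _ "\<lambda>d. d + i" "\<lambda>j. j - i"]) (auto simp: of_nat_diff)
  also have "\<dots> \<le> (\<Sum>d\<in>{1..n}. 1 / real d)"
    using assms by (intro sum_mono2) auto
  finally show ?thesis by (simp add: harm_def inverse_eq_divide)
qed

lemma exp_minus_one_le: "exp x - 1 \<le> x * exp (x::real)"
proof -
  have "(1 - x) * exp x \<le> exp (-x) * exp x"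
    using exp_ge_add_one_self[of "-x"] by (intro mult_right_mono) auto
  then show ?thesis by (simp add: exp_minus algebra_simps)
qed

text \<open>
  Abstract form of the prior: in block \<open>l\<close> one of the vectors \<open>u l i\<close>, \<open>i < m\<close>, is present.  All have
  energy \<open>\<rho>\<close>; \<open>c\<close> measures the correlations inside a block, which decay with the distance of the
  indices, and \<open>\<eta>\<close> the total correlation of different blocks.  The latter is required for two
  configurations \<open>\<sigma>\<close> and \<open>\<sigma>'\<close> because the second moment compares two independent draws.
\<close>

locale block_family =
  fixes N s m :: nat and u :: "nat \<Rightarrow> nat \<Rightarrow> nat \<Rightarrow> complex" and \<rho> c \<eta> :: real
  assumes m_pos: "0 < m" and c_nonneg: "0 \<le> c"
    and energy: "\<And>l i. l \<in> {1..s} \<Longrightarrow> i < m \<Longrightarrow> vec_inner N (u l i) (u l i) = \<rho>"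
    and near: "\<And>l i j. l \<in> {1..s} \<Longrightarrow> i < m \<Longrightarrow> j < m \<Longrightarrow> i \<noteq> j \<Longrightarrow>
      vec_inner N (u l i) (u l j) \<le> c / \<bar>real i - real j\<bar>"
    and cross: "\<And>\<sigma> \<sigma>'. \<sigma> \<in> {1..s} \<rightarrow>\<^sub>E {..<m} \<Longrightarrow> \<sigma>' \<in> {1..s} \<rightarrow>\<^sub>E {..<m} \<Longrightarrow>
      (\<Sum>l\<in>{1..s}. \<Sum>l'\<in>{1..s} - {l}. \<bar>vec_inner N (u l (\<sigma> l)) (u l' (\<sigma>' l'))\<bar>) \<le> \<eta>"
begin

definition choices :: "(nat \<Rightarrow> nat) set" where
  "choices = {1..s} \<rightarrow>\<^sub>E {..<m}"

definition partial_mean :: "nat set \<Rightarrow> (nat \<Rightarrow> nat) \<Rightarrow> nat \<Rightarrow> complex" where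
  "partial_mean A \<sigma> = (\<lambda>j. \<Sum>l\<in>A. u l (\<sigma> l) j)"

abbreviation mean :: "(nat \<Rightarrow> nat) \<Rightarrow> nat \<Rightarrow> complex" where
  "mean \<equiv> partial_mean {1..s}"

definition lr :: "(nat \<Rightarrow> nat) \<Rightarrow> (nat \<Rightarrow> complex) \<Rightarrow> real" where
  "lr \<sigma> z = exp (2 * vec_inner N (mean \<sigma>) z - vec_inner N (mean \<sigma>) (mean \<sigma>))"

definition trunc :: "real \<Rightarrow> (nat \<Rightarrow> nat) \<Rightarrow> (nat \<Rightarrow> complex) set" where
  "trunc T \<sigma> = {z \<in> space (obs_space N). \<forall>l\<in>{1..s}. vec_inner N (u l (\<sigma> l)) z \<le> T}"

lemma finite_choices [simp]: "finite choices"
  by (simp add: choices_def finite_PiE)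

lemma card_choices: "card choices = m ^ s"
  by (simp add: choices_def card_PiE)

lemma card_choices_pos: "0 < card choices"
  using m_pos by (simp add: card_choices)

lemma choices_less: "\<sigma> \<in> choices \<Longrightarrow> l \<in> {1..s} \<Longrightarrow> \<sigma> l < m"
  by (auto simp: choices_def PiE_iff)

lemma measurable_lr [measurable]: "lr \<sigma> \<in> borel_measurable (obs_space N)"
  unfolding lr_def by measurable

lemma sets_trunc [measurable]: "trunc T \<sigma> \<in> sets (obs_space N)"
  unfolding trunc_def by measurable

lemma lr_pos: "0 < lr \<sigma> z"
  by (simp add: lr_def)

lemma integrable_lr: "integrable (noise N) (lr \<sigma>)"
  using integrable_exp_vec_inner[of N "mean \<sigma>" "- vec_inner N (mean \<sigma>) (mean \<sigma>)"]
  by (simp add: lr_def[abs_def])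

lemma integral_lr: "(\<integral>z. lr \<sigma> z \<partial>noise N) = 1"
  using integral_exp_vec_inner[of N "mean \<sigma>" "- vec_inner N (mean \<sigma>) (mean \<sigma>)"]
  by (simp add: lr_def[abs_def])

text \<open>
  In the double sum over pairs of blocks, the pairs of different blocks contribute at most \<open>\<eta>\<close>.
\<close>

lemma inner_partial_means:
  assumes "\<sigma> \<in> choices" "\<sigma>' \<in> choices" "A \<subseteq> {1..s}" "B \<subseteq> {1..s}"
  shows "\<bar>vec_inner N (partial_mean A \<sigma>) (partial_mean B \<sigma>')
      - (\<Sum>l\<in>A \<inter> B. vec_inner N (u l (\<sigma> l)) (u l (\<sigma>' l)))\<bar> \<le> \<eta>"
proof -
  define g where "g l l' = vec_inner N (u l (\<sigma> l)) (u l' (\<sigma>' l'))" for l l'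
  have fin: "finite A" "finite B"
    using assms finite_subset by blast+
  have "vec_inner N (partial_mean A \<sigma>) (partial_mean B \<sigma>') = (\<Sum>l\<in>A. \<Sum>l'\<in>B. g l l')"
    by (simp add: partial_mean_def vec_inner_sum_left vec_inner_sum_right g_def)
  also have "\<dots> = (\<Sum>l\<in>A. (if l \<in> B then g l l else 0) + (\<Sum>l'\<in>B - {l}. g l l'))"
    using fin by (intro sum.cong refl) (auto simp: sum.remove)
  also have "\<dots> = (\<Sum>l\<in>A \<inter> B. g l l) + (\<Sum>l\<in>A. \<Sum>l'\<in>B - {l}. g l l')"
    using fin by (simp add: sum.distrib sum.inter_restrict)
  finally have "\<bar>vec_inner N (partial_mean A \<sigma>) (partial_mean B \<sigma>') - (\<Sum>l\<in>A \<inter> B. g l l)\<bar>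
      = \<bar>\<Sum>l\<in>A. \<Sum>l'\<in>B - {l}. g l l'\<bar>" by simp
  also have "\<dots> \<le> (\<Sum>l\<in>A. \<Sum>l'\<in>B - {l}. \<bar>g l l'\<bar>)"
    by (rule order_trans[OF sum_abs]) (intro sum_mono sum_abs)
  also have "\<dots> \<le> (\<Sum>l\<in>A. \<Sum>l'\<in>{1..s} - {l}. \<bar>g l l'\<bar>)"
    using assms by (intro sum_mono sum_mono2) auto
  also have "\<dots> \<le> (\<Sum>l\<in>{1..s}. \<Sum>l'\<in>{1..s} - {l}. \<bar>g l l'\<bar>)"
    using assms by (intro sum_mono2 sum_nonneg) auto
  also have "\<dots> \<le> \<eta>"
    using cross assms by (simp add: choices_def g_def)
  finally show ?thesis by (simp add: g_def)
qed

lemma inner_partial_means_same: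
  assumes "\<sigma> \<in> choices" "A \<subseteq> {1..s}" "B \<subseteq> {1..s}"
  shows "\<bar>vec_inner N (partial_mean A \<sigma>) (partial_mean B \<sigma>) - card (A \<inter> B) * \<rho>\<bar> \<le> \<eta>"
proof -
  have "(\<Sum>l\<in>A \<inter> B. vec_inner N (u l (\<sigma> l)) (u l (\<sigma> l))) = (\<Sum>l\<in>A \<inter> B. \<rho>)"
    using assms by (intro sum.cong refl energy choices_less) auto
  then show ?thesis
    using inner_partial_means[OF assms(1,1,2,3)] by simp
qed

lemma integrable_truncated: "integrable (noise N) (\<lambda>z. lr \<sigma> z * indicator (trunc T \<sigma>) z)"
  by (rule Bochner_Integration.integrable_bound[OF integrable_lr[of \<sigma>]])
     (auto simp: lr_pos less_imp_le split: split_indicator)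

text \<open>
  A union bound over the blocks and Chernoff's inequality with parameter \<open>v\<close> for each of them: where the
  truncation discards \<open>z\<close>, one of the factors \<open>exp (2 v (\<langle>u, z\<rangle> - T))\<close> exceeds \<open>1\<close>.
\<close>

lemma truncated_first_moment:
  assumes \<sigma>: "\<sigma> \<in> choices" and "0 \<le> v"
  shows "1 - s * exp (2 * v * \<rho> + v\<^sup>2 * \<rho> - 2 * v * T + 2 * v * \<eta>)
    \<le> (\<integral>z. lr \<sigma> z * indicator (trunc T \<sigma>) z \<partial>noise N)"
proof -
  define k where "k = - vec_inner N (mean \<sigma>) (mean \<sigma>) - 2 * v * T"
  define a where "a l = (\<lambda>j. mean \<sigma> j + v *\<^sub>R u l (\<sigma> l) j)" for l
  have tilt: "lr \<sigma> z * exp (2 * v * (vec_inner N (u l (\<sigma> l)) z - T))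
      = exp (2 * vec_inner N (a l) z + k)" for l z
    by (simp add: lr_def mult_exp_exp a_def k_def vec_inner_simps algebra_simps)
  have int: "integrable (noise N) (\<lambda>z. lr \<sigma> z - (\<Sum>l\<in>{1..s}. exp (2 * vec_inner N (a l) z + k)))"
    by (intro Bochner_Integration.integrable_diff integrable_lr Bochner_Integration.integrable_sum
        integrable_exp_vec_inner)
  have val: "exp (vec_inner N (a l) (a l) + k)
      \<le> exp (2 * v * \<rho> + v\<^sup>2 * \<rho> - 2 * v * T + 2 * v * \<eta>)" if l: "l \<in> {1..s}" for l
  proof -
    have "vec_inner N (mean \<sigma>) (u l (\<sigma> l)) \<le> \<rho> + \<eta>"
      using inner_partial_means_same[OF \<sigma>, of "{1..s}" "{l}"] l
      by (simp add: partial_mean_def)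
    then have "2 * v * vec_inner N (mean \<sigma>) (u l (\<sigma> l)) \<le> 2 * v * (\<rho> + \<eta>)"
      using \<open>0 \<le> v\<close> by (intro mult_left_mono) auto
    moreover have "vec_inner N (a l) (a l) + k
        = 2 * v * vec_inner N (mean \<sigma>) (u l (\<sigma> l)) + v\<^sup>2 * \<rho> - 2 * v * T"
      using energy[OF l choices_less[OF \<sigma> l]] vec_inner_commute[of N "u l (\<sigma> l)" "mean \<sigma>"]
      by (simp add: a_def k_def vec_inner_simps power2_eq_square algebra_simps)
    ultimately show ?thesis by (simp add: algebra_simps)
  qed
  have "1 - s * exp (2 * v * \<rho> + v\<^sup>2 * \<rho> - 2 * v * T + 2 * v * \<eta>)
      \<le> 1 - (\<Sum>l\<in>{1..s}. exp (vec_inner N (a l) (a l) + k))"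
    using sum_bounded_above[of "{1..s}", OF val] by simp
  also have "\<dots> = (\<integral>z. lr \<sigma> z - (\<Sum>l\<in>{1..s}. exp (2 * vec_inner N (a l) z + k)) \<partial>noise N)"
    by (subst Bochner_Integration.integral_diff,
        (intro integrable_lr Bochner_Integration.integrable_sum integrable_exp_vec_inner)+,
        subst Bochner_Integration.integral_sum)
       (simp_all only: integral_lr integral_exp_vec_inner integrable_exp_vec_inner)
  also have "\<dots> \<le> (\<integral>z. lr \<sigma> z * indicator (trunc T \<sigma>) z \<partial>noise N)"
  proof (intro integral_mono int integrable_truncated)
    fix z assume z: "z \<in> space (noise N)"
    show "lr \<sigma> z - (\<Sum>l\<in>{1..s}. exp (2 * vec_inner N (a l) z + k))
        \<le> lr \<sigma> z * indicator (trunc T \<sigma>) z"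
    proof (cases "z \<in> trunc T \<sigma>")
      case True
      then show ?thesis by (simp add: sum_nonneg)
    next
      case False
      then obtain l where l: "l \<in> {1..s}" "T < vec_inner N (u l (\<sigma> l)) z"
        using z by (auto simp: trunc_def)
      have "lr \<sigma> z * 1 \<le> lr \<sigma> z * exp (2 * v * (vec_inner N (u l (\<sigma> l)) z - T))"
        using l \<open>0 \<le> v\<close> by (intro mult_left_mono) (auto simp: lr_pos less_imp_le)
      also have "\<dots> \<le> (\<Sum>l\<in>{1..s}. exp (2 * vec_inner N (a l) z + k))"
        unfolding tilt using l by (intro member_le_sum) auto
      finally show ?thesis using False by simp
    qed
  qed
  finally show ?thesis .
qed

text \<open>
  The bound, up to a common factor, for the contribution of a block to the second moment when two
  independent draws choose \<open>i\<close> and \<open>j\<close> in it.  In terms of the Chernoff parameter \<open>v\<close> and the truncation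
  level \<open>T\<close>, the exponent will be \<open>\<kappa> = (2 - 4 v + v\<^sup>2) \<rho> + 2 v T\<close>, equal to \<open>2 \<rho>\<close> for \<open>v = 0\<close>.
\<close>

definition overlap_weight :: "real \<Rightarrow> nat \<Rightarrow> nat \<Rightarrow> real" where
  "overlap_weight \<kappa> i j = (if i = j then exp \<kappa> else exp (2 * c / \<bar>real i - real j\<bar>))"

text \<open>
  On both truncation events each column shared by \<open>\<sigma>\<close> and \<open>\<sigma>'\<close> satisfies
  \<open>\<langle>u, z\<rangle> \<le> T\<close>, so the product of the likelihood ratios may be multiplied by
  \<open>exp (2 v (T - \<langle>u, z\<rangle>)) \<ge> 1\<close> for every shared column.  The parameter \<open>v\<close> is at our disposal;
  without truncation (\<open>v = 0\<close>) a shared column costs \<open>exp (2 \<rho>)\<close>, which is too much for strong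
  signals.  Columns of the same block that differ contribute their correlation only.
\<close>

lemma truncated_product:
  assumes \<sigma>: "\<sigma> \<in> choices" "\<sigma>' \<in> choices" and "0 \<le> v"
    and \<kappa>: "\<kappa> = (2 - 4 * v + v\<^sup>2) * \<rho> + 2 * v * T"
  shows "integrable (noise N) (\<lambda>z. (lr \<sigma> z * indicator (trunc T \<sigma>) z)
        * (lr \<sigma>' z * indicator (trunc T \<sigma>') z))" (is "integrable _ ?f")
    and "(\<integral>z. (lr \<sigma> z * indicator (trunc T \<sigma>) z) * (lr \<sigma>' z * indicator (trunc T \<sigma>') z) \<partial>noise N)
      \<le> exp ((2 + 4 * v + v\<^sup>2) * \<eta>) * (\<Prod>l\<in>{1..s}. overlap_weight \<kappa> (\<sigma> l) (\<sigma>' l))"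
proof -
  define J where "J = {l \<in> {1..s}. \<sigma> l = \<sigma>' l}"
  \<comment> \<open>The set \<open>J\<close> collects the blocks on which the configurations agree, and \<open>w\<close> is their common part,
    so that \<open>a\<close> is the total exponential tilt.\<close>
  define w where "w = partial_mean J \<sigma>"
  have w': "w = partial_mean J \<sigma>'"
    unfolding w_def partial_mean_def J_def by (intro ext sum.cong) auto
  have J: "J \<subseteq> {1..s}" "finite J" by (auto simp: J_def)
  define a where "a = (\<lambda>j. (mean \<sigma> j + mean \<sigma>' j) + (- v) *\<^sub>R w j)"
  define k where "k = - vec_inner N (mean \<sigma>) (mean \<sigma>) - vec_inner N (mean \<sigma>') (mean \<sigma>')
      + 2 * v * T * card J"
  have bound: "?f z \<le> exp (2 * vec_inner N a z + k)" for z
  proof (cases "z \<in> trunc T \<sigma>")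
    case True
    then have "vec_inner N w z \<le> card J * T"
      unfolding w_def partial_mean_def vec_inner_sum_left
      using J by (intro sum_bounded_above) (auto simp: trunc_def)
    then have "2 * v * vec_inner N w z \<le> 2 * v * (card J * T)"
      using \<open>0 \<le> v\<close> by (intro mult_left_mono) auto
    then have "lr \<sigma> z * lr \<sigma>' z \<le> exp (2 * vec_inner N a z + k)"
      unfolding lr_def mult_exp_exp a_def k_def vec_inner_simps by (simp add: algebra_simps)
    then show ?thesis
      using lr_pos[of \<sigma> z] lr_pos[of \<sigma>' z] by (auto split: split_indicator)
  qed simp
  have nonneg: "0 \<le> ?f z" for z
    using lr_pos[of \<sigma> z] lr_pos[of \<sigma>' z] by (auto split: split_indicator)
  show i: "integrable (noise N) ?f"
    by (rule Bochner_Integration.integrable_bound[OF integrable_exp_vec_inner[of N a k]])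
       (use bound nonneg in auto)
  have "(\<integral>z. ?f z \<partial>noise N) \<le> exp (vec_inner N a a + k)"
    unfolding integral_exp_vec_inner[symmetric]
    by (intro integral_mono i integrable_exp_vec_inner bound)
  \<comment> \<open>Expanding the squares leaves inner products of sums over blocks.  Those carrying a negative sign are
    bounded below; dropping the terms between different blocks costs a multiple of \<open>\<eta>\<close>.\<close>
  also have "\<dots> \<le> exp ((2 + 4 * v + v\<^sup>2) * \<eta>
      + (\<Sum>l\<in>{1..s}. if \<sigma> l = \<sigma>' l then \<kappa> else 2 * c / \<bar>real (\<sigma> l) - real (\<sigma>' l)\<bar>))"
  proof -
    have "vec_inner N (mean \<sigma>) (mean \<sigma>')
        \<le> (\<Sum>l\<in>{1..s}. vec_inner N (u l (\<sigma> l)) (u l (\<sigma>' l))) + \<eta>"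
      using inner_partial_means[OF \<sigma>, of "{1..s}" "{1..s}"] by simp
    also have "(\<Sum>l\<in>{1..s}. vec_inner N (u l (\<sigma> l)) (u l (\<sigma>' l)))
        \<le> (\<Sum>l\<in>{1..s}. if \<sigma> l = \<sigma>' l then \<rho> else c / \<bar>real (\<sigma> l) - real (\<sigma>' l)\<bar>)"
      using \<sigma> by (intro sum_mono) (auto simp: energy near choices_less)
    finally have 1: "2 * vec_inner N (mean \<sigma>) (mean \<sigma>')
        \<le> 2 * (\<Sum>l\<in>{1..s}. if \<sigma> l = \<sigma>' l then \<rho> else c / \<bar>real (\<sigma> l) - real (\<sigma>' l)\<bar>) + 2 * \<eta>"
      by simp
    have "card J * \<rho> - \<eta> \<le> vec_inner N (mean \<sigma>) w" "card J * \<rho> - \<eta> \<le> vec_inner N (mean \<sigma>') w"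
      using inner_partial_means_same[OF \<sigma>(1), of "{1..s}" J]
        inner_partial_means_same[OF \<sigma>(2), of "{1..s}" J] J
      unfolding w_def[symmetric] w'[symmetric] by (simp_all add: Int_absorb1)
    then have 2: "2 * v * (card J * \<rho> - \<eta>) \<le> 2 * v * vec_inner N (mean \<sigma>) w"
        "2 * v * (card J * \<rho> - \<eta>) \<le> 2 * v * vec_inner N (mean \<sigma>') w"
      using \<open>0 \<le> v\<close> by (auto intro!: mult_left_mono)
    have "vec_inner N w w \<le> card J * \<rho> + \<eta>"
      using inner_partial_means_same[OF \<sigma>(1), of J J] J unfolding w_def[symmetric] by simp
    then have 3: "v\<^sup>2 * vec_inner N w w \<le> v\<^sup>2 * (card J * \<rho> + \<eta>)"
      by (intro mult_left_mono) auto
    have sym: "vec_inner N (mean \<sigma>') (mean \<sigma>) = vec_inner N (mean \<sigma>) (mean \<sigma>')"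
        "vec_inner N w (mean \<sigma>) = vec_inner N (mean \<sigma>) w"
        "vec_inner N w (mean \<sigma>') = vec_inner N (mean \<sigma>') w"
      by (simp_all add: vec_inner_commute)
    have "vec_inner N a a + k = 2 * vec_inner N (mean \<sigma>) (mean \<sigma>')
        - 2 * v * vec_inner N (mean \<sigma>) w - 2 * v * vec_inner N (mean \<sigma>') w
        + v\<^sup>2 * vec_inner N w w + 2 * v * T * card J"
      unfolding a_def k_def vec_inner_simps sym by (simp add: power2_eq_square algebra_simps)
    also have "\<dots> \<le> 2 * (\<Sum>l\<in>{1..s}. if \<sigma> l = \<sigma>' l then \<rho> else c / \<bar>real (\<sigma> l) - real (\<sigma>' l)\<bar>)
        + 2 * \<eta> - 4 * v * (card J * \<rho> - \<eta>) + v\<^sup>2 * (card J * \<rho> + \<eta>) + 2 * v * T * card J"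
      using 1 2 3 by simp
    also have "\<dots> = (2 + 4 * v + v\<^sup>2) * \<eta>
        + (2 * (\<Sum>l\<in>{1..s}. if \<sigma> l = \<sigma>' l then \<rho> else c / \<bar>real (\<sigma> l) - real (\<sigma>' l)\<bar>)
           + card J * (\<kappa> - 2 * \<rho>))"
      by (simp add: \<kappa> algebra_simps)
    also have "card J * (\<kappa> - 2 * \<rho>) = (\<Sum>l\<in>{1..s}. if \<sigma> l = \<sigma>' l then \<kappa> - 2 * \<rho> else 0)"
      unfolding J_def by (simp add: sum.If_cases Int_def conj_commute)
    also have "2 * (\<Sum>l\<in>{1..s}. if \<sigma> l = \<sigma>' l then \<rho> else c / \<bar>real (\<sigma> l) - real (\<sigma>' l)\<bar>) + \<dots>
        = (\<Sum>l\<in>{1..s}. if \<sigma> l = \<sigma>' l then \<kappa> else 2 * c / \<bar>real (\<sigma> l) - real (\<sigma>' l)\<bar>)"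
      unfolding sum_distrib_left sum.distrib[symmetric] by (intro sum.cong refl) auto
    finally show ?thesis by simp
  qed
  also have "\<dots> = exp ((2 + 4 * v + v\<^sup>2) * \<eta>) * (\<Prod>l\<in>{1..s}. overlap_weight \<kappa> (\<sigma> l) (\<sigma>' l))"
    unfolding exp_add exp_sum[OF finite_atLeastAtMost] overlap_weight_def
    by (intro arg_cong2[where f="(*)"] prod.cong refl) auto
  finally show "(\<integral>z. ?f z \<partial>noise N) \<le> \<dots>" .
qed

text \<open>
  Agreement costs \<open>exp \<kappa>\<close> for one index in \<open>m\<close>; the excess over \<open>1\<close> of all other weights sums to
  a logarithm by the decay of correlations.
\<close>

lemma sum_overlap_weight:
  assumes "i < m"
  shows "(\<Sum>j<m. overlap_weight \<kappa> i j) \<le> m + (exp \<kappa> + 4 * c * exp (2 * c) * harm m)"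
proof -
  have "(\<Sum>j<m. overlap_weight \<kappa> i j) = exp \<kappa> + (\<Sum>j\<in>{..<m} - {i}. overlap_weight \<kappa> i j)"
    using assms by (simp add: sum.remove[of _ i] overlap_weight_def)
  also have "(\<Sum>j\<in>{..<m} - {i}. overlap_weight \<kappa> i j)
      \<le> (\<Sum>j\<in>{..<m} - {i}. 1 + 2 * c * exp (2 * c) * (1 / \<bar>real i - real j\<bar>))"
  proof (rule sum_mono)
    fix j assume j: "j \<in> {..<m} - {i}"
    let ?x = "2 * c / \<bar>real i - real j\<bar>"
    have "1 \<le> \<bar>real i - real j\<bar>" using j by auto
    then have "?x \<le> 2 * c / 1" using c_nonneg by (intro divide_left_mono) auto
    then have "?x \<le> 2 * c" by simp
    have "exp ?x \<le> 1 + ?x * exp ?x" using exp_minus_one_le[of ?x] by simp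
    also have "\<dots> \<le> 1 + ?x * exp (2 * c)"
      using \<open>?x \<le> 2 * c\<close> c_nonneg by (intro add_left_mono mult_left_mono) auto
    finally show "overlap_weight \<kappa> i j \<le> 1 + 2 * c * exp (2 * c) * (1 / \<bar>real i - real j\<bar>)"
      using j by (simp add: overlap_weight_def mult_ac)
  qed
  also have "\<dots> = (m - 1) + 2 * c * exp (2 * c) * (\<Sum>j\<in>{..<m} - {i}. 1 / \<bar>real i - real j\<bar>)"
    using assms by (simp add: sum.distrib sum_distrib_left)
  also have "\<dots> \<le> m + 2 * c * exp (2 * c) * (2 * harm m)"
    using assms c_nonneg by (intro add_mono mult_left_mono sum_inverse_dist_le_harm) auto
  finally show ?thesis by (simp add: mult_ac)
qed

definition truncated_mixture :: "real \<Rightarrow> (nat \<Rightarrow> complex) \<Rightarrow> real" where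
  "truncated_mixture T z = (\<Sum>\<sigma>\<in>choices. lr \<sigma> z * indicator (trunc T \<sigma>) z) / card choices"

lemma integrable_truncated_mixture: "integrable (noise N) (truncated_mixture T)"
  unfolding truncated_mixture_def
  by (intro Bochner_Integration.integrable_divide Bochner_Integration.integrable_sum
      integrable_truncated)

lemma truncated_mixture_mean:
  assumes "0 \<le> v"
  shows "1 - s * exp (2 * v * \<rho> + v\<^sup>2 * \<rho> - 2 * v * T + 2 * v * \<eta>)
    \<le> (\<integral>z. truncated_mixture T z \<partial>noise N)" (is "?b \<le> _")
proof -
  have "card choices * ?b
      \<le> (\<Sum>\<sigma>\<in>choices. \<integral>z. lr \<sigma> z * indicator (trunc T \<sigma>) z \<partial>noise N)"
    using truncated_first_moment[OF _ assms] by (intro sum_bounded_below) auto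
  also have "\<dots> = card choices * (\<integral>z. truncated_mixture T z \<partial>noise N)"
    using card_choices_pos unfolding truncated_mixture_def integral_divide_zero
    by (subst Bochner_Integration.integral_sum) (auto intro: integrable_truncated)
  finally show ?thesis
    using card_choices_pos by simp
qed

text \<open>
  For fixed \<open>\<sigma>\<close> the sum over \<open>\<sigma>'\<close> of a product over blocks is a product of sums, so the blocks
  decouple and each contributes a factor \<open>1 + \<xi> \<le> exp \<xi>\<close>.
\<close>

lemma truncated_mixture_second_moment:
  assumes "0 \<le> v" and \<kappa>: "\<kappa> = (2 - 4 * v + v\<^sup>2) * \<rho> + 2 * v * T"
  shows "integrable (noise N) (\<lambda>z. (truncated_mixture T z)\<^sup>2)"
    and "(\<integral>z. (truncated_mixture T z)\<^sup>2 \<partial>noise N)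
      \<le> exp ((2 + 4 * v + v\<^sup>2) * \<eta> + s * (exp \<kappa> + 4 * c * exp (2 * c) * harm m) / m)"
proof -
  define f where "f \<sigma> z = lr \<sigma> z * indicator (trunc T \<sigma>) z" for \<sigma> z
  define \<xi> where "\<xi> = (exp \<kappa> + 4 * c * exp (2 * c) * harm m) / m"
  define E where "E = exp ((2 + 4 * v + v\<^sup>2) * \<eta>)"
  have \<xi>: "0 \<le> \<xi>" unfolding \<xi>_def using c_nonneg harm_nonneg[of m, where 'a=real]
    by (intro divide_nonneg_nonneg add_nonneg_nonneg mult_nonneg_nonneg) auto
  note prod = truncated_product[OF _ _ \<open>0 \<le> v\<close> \<kappa>, folded f_def E_def]
  have eq: "(truncated_mixture T z)\<^sup>2 = (\<Sum>\<sigma>\<in>choices. \<Sum>\<sigma>'\<in>choices. f \<sigma> z * f \<sigma>' z) / (card choices)\<^sup>2"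
    for z
    unfolding truncated_mixture_def f_def power2_eq_square times_divide_times_eq sum_product
    by simp
  show "integrable (noise N) (\<lambda>z. (truncated_mixture T z)\<^sup>2)"
    unfolding eq
    by (intro Bochner_Integration.integrable_divide Bochner_Integration.integrable_sum prod)
  have inner: "(\<Sum>\<sigma>'\<in>choices. \<integral>z. f \<sigma> z * f \<sigma>' z \<partial>noise N)
      \<le> card choices * (E * exp (s * \<xi>))" if \<sigma>: "\<sigma> \<in> choices" for \<sigma>
  proof -
    have "(\<Sum>\<sigma>'\<in>choices. \<integral>z. f \<sigma> z * f \<sigma>' z \<partial>noise N)
        \<le> (\<Sum>\<sigma>'\<in>choices. E * (\<Prod>l\<in>{1..s}. overlap_weight \<kappa> (\<sigma> l) (\<sigma>' l)))"
      using \<sigma> by (intro sum_mono prod)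
    also have "\<dots> = E * (\<Prod>l\<in>{1..s}. \<Sum>j<m. overlap_weight \<kappa> (\<sigma> l) j)"
      unfolding sum_distrib_left[symmetric] choices_def
      by (subst prod_sum_PiE) auto
    also have "\<dots> \<le> E * (\<Prod>l\<in>{1..s}. m * (1 + \<xi>))"
    proof (intro mult_left_mono prod_mono conjI)
      fix l assume l: "l \<in> {1..s}"
      have "m * (1 + \<xi>) = m + (exp \<kappa> + 4 * c * exp (2 * c) * harm m)"
        using m_pos by (simp add: \<xi>_def field_simps)
      with sum_overlap_weight[OF choices_less[OF \<sigma> l], of \<kappa>]
      show "(\<Sum>j<m. overlap_weight \<kappa> (\<sigma> l) j) \<le> m * (1 + \<xi>)"
        by linarith
    qed (auto simp: overlap_weight_def E_def intro!: sum_nonneg)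
    also have "\<dots> = card choices * (E * (1 + \<xi>) ^ s)"
      by (simp add: card_choices power_mult_distrib)
    also have "\<dots> \<le> card choices * (E * exp \<xi> ^ s)"
      using \<xi> exp_ge_add_one_self[of \<xi>] by (intro mult_left_mono power_mono) (auto simp: E_def)
    finally show ?thesis by (simp add: exp_of_nat_mult)
  qed
  have "(\<integral>z. (truncated_mixture T z)\<^sup>2 \<partial>noise N)
      = (\<Sum>\<sigma>\<in>choices. \<Sum>\<sigma>'\<in>choices. \<integral>z. f \<sigma> z * f \<sigma>' z \<partial>noise N) / (card choices)\<^sup>2"
    unfolding eq
    by (simp add: Bochner_Integration.integral_sum prod Bochner_Integration.integrable_sum)
  also have "\<dots> \<le> (card choices * (card choices * (E * exp (s * \<xi>)))) / (card choices)\<^sup>2"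
    by (intro divide_right_mono sum_bounded_above inner) auto
  also have "\<dots> = E * exp (s * \<xi>)"
    using card_choices_pos by (cases "choices = {}") (auto simp: power2_eq_square)
  finally show "(\<integral>z. (truncated_mixture T z)\<^sup>2 \<partial>noise N)
      \<le> exp ((2 + 4 * v + v\<^sup>2) * \<eta> + s * (exp \<kappa> + 4 * c * exp (2 * c) * harm m) / m)"
    by (simp add: E_def \<xi>_def exp_add)
qed

lemma mixture_risk_bound:
  assumes "0 \<le> v1" "0 \<le> v2" and R: "R \<in> sets (obs_space N)"
    and \<kappa>: "\<kappa> = (2 - 4 * v2 + v2\<^sup>2) * \<rho> + 2 * v2 * T"
  shows "1 - sqrt (2 * (s * exp (2 * v1 * \<rho> + v1\<^sup>2 * \<rho> - 2 * v1 * T + 2 * v1 * \<eta>))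
        + (exp ((2 + 4 * v2 + v2\<^sup>2) * \<eta> + s * (exp \<kappa> + 4 * c * exp (2 * c) * harm m) / m) - 1))
    \<le> measure (noise N) R
      + (\<Sum>\<sigma>\<in>choices. \<integral>z. indicator (space (obs_space N) - R) z * lr \<sigma> z \<partial>noise N) / card choices"
proof -
  interpret prob_space "noise N" by (rule prob_space_noise)
  let ?I = "indicator (space (obs_space N) - R) :: _ \<Rightarrow> real"
  have [measurable]: "R \<in> sets (obs_space N)" by fact
  have ilr: "integrable (noise N) (\<lambda>z. ?I z * lr \<sigma> z)" for \<sigma>
    by (rule Bochner_Integration.integrable_bound[OF integrable_lr[of \<sigma>]])
       (auto simp: lr_pos less_imp_le split: split_indicator)
  have iH: "integrable (noise N) (\<lambda>z. ?I z * truncated_mixture T z)"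
    by (rule Bochner_Integration.integrable_bound[OF integrable_truncated_mixture[of T]])
       (use integrable_truncated_mixture[of T] in \<open>auto split: split_indicator\<close>)
  have "(\<integral>z. ?I z * truncated_mixture T z \<partial>noise N)
      \<le> (\<integral>z. (\<Sum>\<sigma>\<in>choices. ?I z * lr \<sigma> z) / card choices \<partial>noise N)"
  proof (intro integral_mono iH Bochner_Integration.integrable_divide
      Bochner_Integration.integrable_sum ilr)
    fix z
    show "?I z * truncated_mixture T z \<le> (\<Sum>\<sigma>\<in>choices. ?I z * lr \<sigma> z) / card choices"
      unfolding truncated_mixture_def sum_distrib_left times_divide_eq_right
      by (intro divide_right_mono sum_mono) (auto simp: lr_pos less_imp_le split: split_indicator)
  qed
  also have "\<dots> = (\<Sum>\<sigma>\<in>choices. \<integral>z. ?I z * lr \<sigma> z \<partial>noise N) / card choices"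
    unfolding integral_divide_zero
    by (subst Bochner_Integration.integral_sum) (auto intro: ilr)
  finally have le: "(\<integral>z. ?I z * truncated_mixture T z \<partial>noise N) \<le> \<dots>" .
  show ?thesis
    using testing_lower_bound[OF integrable_truncated_mixture
      truncated_mixture_second_moment(1)[OF \<open>0 \<le> v2\<close> \<kappa>]
      truncated_mixture_mean[OF \<open>0 \<le> v1\<close>], of
        "exp ((2 + 4 * v2 + v2\<^sup>2) * \<eta> + s * (exp \<kappa> + 4 * c * exp (2 * c) * harm m) / m) - 1" R]
      truncated_mixture_second_moment(2)[OF \<open>0 \<le> v2\<close> \<kappa>] R le
    by simp
qed

end

section \<open>Correlations of the Fourier design\<close>

text \<open>
  Jordan's inequality: the sine is concave on the interval and hence lies above its chord.
\<close>

lemma jordan_sin_lower_bound: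
  assumes "0 \<le> x" "x \<le> pi / 2"
  shows "2 * x / pi \<le> sin x"
proof -
  have "convex_on {0..pi/2} (\<lambda>x. - sin x)"
    by (rule f''_ge0_imp_convex[where f' = "\<lambda>x. - cos x" and f'' = sin])
       (auto intro!: derivative_eq_intros sin_ge_zero simp: pi_ge_two)
  from convex_onD[OF this, of "2 * x / pi" 0 "pi / 2"] show ?thesis
    using assms by (simp add: field_simps)
qed

text \<open>
  The classical bound for the Dirichlet kernel, uniform in the number of summands.
\<close>

lemma cos_geometric_sum_bound:
  assumes "sin (\<theta> / 2) \<noteq> 0"
  shows "\<bar>\<Sum>j\<in>{1..N}. cos (\<theta> * (real j - 1))\<bar> \<le> 1 / \<bar>sin (\<theta> / 2)\<bar>"
proof -
  have dist: "cmod (cis \<theta> - 1) = 2 * \<bar>sin (\<theta> / 2)\<bar>"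
  proof -
    have "(cmod (cis \<theta> - 1))\<^sup>2 = (cos \<theta> - 1)\<^sup>2 + (sin \<theta>)\<^sup>2"
      by (simp add: cmod_power2)
    also have "\<dots> = 2 - 2 * cos (2 * (\<theta> / 2))"
      using sin_cos_squared_add[of \<theta>] by (simp add: power2_diff)
    also have "\<dots> = (2 * \<bar>sin (\<theta> / 2)\<bar>)\<^sup>2"
      by (simp only: cos_double_sin) (simp add: power_mult_distrib)
    finally show ?thesis by (rule power2_eq_imp_eq) auto
  qed
  then have ne: "cis \<theta> \<noteq> 1" using assms by auto
  have "(\<Sum>j\<in>{1..N}. cos (\<theta> * (real j - 1))) = (\<Sum>i<N. cos (\<theta> * real i))"
    by (rule sum.reindex_bij_witness[of _ Suc "\<lambda>j. j - 1"]) auto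
  also have "\<dots> = Re (\<Sum>i<N. cis \<theta> ^ i)"
    unfolding Re_sum
    by (intro sum.cong refl) (metis Complex.DeMoivre cis.sel(1) mult.commute)
  finally have "\<bar>\<Sum>j\<in>{1..N}. cos (\<theta> * (real j - 1))\<bar> \<le> cmod (\<Sum>i<N. cis \<theta> ^ i)"
    by (simp only: abs_Re_le_cmod)
  also have "\<dots> = cmod (cis \<theta> ^ N - 1) / cmod (cis \<theta> - 1)"
    using geometric_sum[OF ne] by (simp add: norm_divide)
  also have "\<dots> \<le> 2 / cmod (cis \<theta> - 1)"
    using norm_triangle_ineq4[of "cis \<theta> ^ N" 1]
    by (intro divide_right_mono) (auto simp: norm_power)
  finally show ?thesis by (simp add: dist)
qed

lemma inner_dft_design:
  assumes "0 < p"
  shows "dft_design p j k \<bullet> dft_design p j k'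
    = cos (2 * pi * (real k - real k') / p * (real j - 1)) / p"
proof -
  have cis: "dft_design p j k = (1 / sqrt p) *\<^sub>R cis (- (2 * pi * (real k - 1) * (real j - 1) / p))" for k
    unfolding dft_design_def cis_conv_exp scaleR_conv_of_real
    by (simp add: divide_inverse mult_ac)
  have "dft_design p j k \<bullet> dft_design p j k'
      = cos (2 * pi * (real k - 1) * (real j - 1) / p - 2 * pi * (real k' - 1) * (real j - 1) / p) / p"
    unfolding cis cos_diff inner_scaleR_left inner_scaleR_right using assms
    by (simp add: inner_complex_def field_simps)
  also have "2 * pi * (real k - 1) * (real j - 1) / p - 2 * pi * (real k' - 1) * (real j - 1) / p
      = 2 * pi * (real k - real k') / p * (real j - 1)"
    by (simp add: divide_simps algebra_simps)
  finally show ?thesis .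
qed

lemma dft_design_energy:
  assumes "0 < p"
  shows "vec_inner N (\<lambda>j. dft_design p j k) (\<lambda>j. dft_design p j k) = N / p"
  using assms by (simp add: vec_inner_def inner_dft_design)

lemma dft_design_correlation:
  assumes "0 < p" "k \<noteq> k'" "2 * \<bar>real k - real k'\<bar> \<le> p"
  shows "\<bar>vec_inner N (\<lambda>j. dft_design p j k) (\<lambda>j. dft_design p j k')\<bar> \<le> 1 / (2 * \<bar>real k - real k'\<bar>)"
proof -
  let ?\<theta> = "2 * pi * (real k - real k') / p"
  let ?d = "\<bar>real k - real k'\<bar>"
  have "2 * (pi * ?d / p) / pi \<le> sin (pi * ?d / p)"
    using assms by (intro jordan_sin_lower_bound) (auto simp: field_simps)
  also have "\<dots> \<le> \<bar>sin (?\<theta> / 2)\<bar>"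
  proof -
    have "pi * ?d / p = \<bar>?\<theta> / 2\<bar>"
      by (simp add: abs_mult abs_divide)
    moreover have "sin \<bar>x\<bar> \<le> \<bar>sin x\<bar>" for x :: real
      by (cases "0 \<le> x") auto
    ultimately show ?thesis by metis
  qed
  finally have s: "2 * ?d / p \<le> \<bar>sin (?\<theta> / 2)\<bar>" by simp
  have pos: "0 < 2 * ?d / p" using assms by simp
  have "\<bar>vec_inner N (\<lambda>j. dft_design p j k) (\<lambda>j. dft_design p j k')\<bar>
      = \<bar>\<Sum>j\<in>{1..N}. cos (?\<theta> * (real j - 1))\<bar> / p"
    using assms by (simp add: vec_inner_def inner_dft_design sum_divide_distrib[symmetric])
  also have "\<dots> \<le> (1 / \<bar>sin (?\<theta> / 2)\<bar>) / p"
    using s pos by (intro divide_right_mono cos_geometric_sum_bound) auto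
  also have "\<dots> \<le> (1 / (2 * ?d / p)) / p"
    using s pos by (intro divide_right_mono divide_left_mono mult_pos_pos) auto
  finally show ?thesis using assms by simp
qed

section \<open>A prior on the parameter space\<close>

text \<open>
  The concrete prior: \<open>m\<close> grid points of spacing \<open>g\<close> in each of \<open>s\<close> blocks.  Blocks start \<open>2 m\<close> grid
  steps apart, so points of the blocks \<open>l\<close> and \<open>l'\<close> are at least \<open>m |l - l'|\<close> steps apart.
  Everything lies in the first half of \<open>{1..p}\<close>, where cyclic and ordinary distances agree; this
  is the room for the factor \<open>4\<close>.
\<close>

locale block_prior =
  fixes p N s m g :: nat and r :: real
  assumes pos: "1 \<le> N" "1 \<le> s" "1 \<le> m" "1 \<le> g" "0 < r"
    and room: "4 * m * s * g \<le> p"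
    and separated: "(ln (real N))\<^sup>2 / N \<le> g / p"
begin

definition grid :: "nat \<Rightarrow> nat \<Rightarrow> nat" where
  "grid l i = 1 + g * (2 * m * (l - 1) + i)"

definition amplitude :: real where
  "amplitude = sqrt (r * p * ln p / N)"

definition column :: "nat \<Rightarrow> nat \<Rightarrow> nat \<Rightarrow> complex" where
  "column l i = (\<lambda>j. amplitude *\<^sub>R dft_design p j (grid l i))"

text \<open>
  An upper bound for the inner product of two signal columns that are one grid step apart.
\<close>

definition corr :: real where
  "corr = r * p * ln p / (2 * N * g)"

definition positions :: "(nat \<Rightarrow> nat) \<Rightarrow> nat \<Rightarrow> nat" where
  "positions \<sigma> = (\<lambda>l\<in>{1..s}. grid l (\<sigma> l))"

definition amplitudes :: "nat \<Rightarrow> complex" where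
  "amplitudes = (\<lambda>l\<in>{1..s}. of_real amplitude)"

lemma p_pos: "1 \<le> p"
proof -
  have "0 < 4 * m * s * g" using pos by simp
  then show ?thesis using room by linarith
qed

lemma amplitude_sq: "amplitude\<^sup>2 = r * p * ln p / N"
  unfolding amplitude_def using pos p_pos by (intro real_sqrt_pow2) auto

lemma corr_nonneg: "0 \<le> corr"
  unfolding corr_def using pos p_pos by auto

lemma grid_half: "l \<in> {1..s} \<Longrightarrow> i < m \<Longrightarrow> 2 * grid l i \<le> p"
proof -
  assume l: "l \<in> {1..s}" and i: "i < m"
  have "2 * m * (l - 1) \<le> 2 * m * (s - 1)"
    using l by (intro mult_le_mono2) auto
  then have "2 * m * (l - 1) + i + 1 \<le> 2 * m * (s - 1) + m"
    using i by linarith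
  also have "\<dots> \<le> 2 * m * s"
    using pos by (cases s) auto
  finally have "g * (2 * m * (l - 1) + i + 1) \<le> g * (2 * m * s)" by (rule mult_le_mono2)
  moreover have "grid l i \<le> g * (2 * m * (l - 1) + i + 1)"
    using pos by (simp add: grid_def)
  moreover have "2 * (g * (2 * m * s)) = 4 * m * s * g" by simp
  ultimately show ?thesis using room by linarith
qed

lemma grid_diff:
  assumes "l \<in> {1..s}" "l' \<in> {1..s}"
  shows "real (grid l i) - real (grid l' i')
    = g * (2 * real m * (real l - real l') + (real i - real i'))"
proof -
  have "real (grid l i) = 1 + g * (2 * real m * (real l - 1) + i)" if "l \<in> {1..s}" for l i
    using that by (simp add: grid_def of_nat_diff)
  from this[OF assms(1)] this[OF assms(2)] show ?thesis by (simp only:) (simp add: algebra_simps)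
qed

lemma column_inner:
  assumes l: "l \<in> {1..s}" "l' \<in> {1..s}" and i: "i < m" "i' < m"
    and D: "0 < D" "D \<le> \<bar>2 * real m * (real l - real l') + (real i - real i')\<bar>"
  shows "\<bar>vec_inner N (column l i) (column l' i')\<bar> \<le> corr / D"
proof -
  let ?d = "\<bar>real (grid l i) - real (grid l' i')\<bar>"
  have dD: "g * D \<le> ?d"
    unfolding grid_diff[OF l] abs_mult using D by (simp add: mult_left_mono)
  have gD: "0 < g * D" using pos D by simp
  have "?d \<le> p / 2"
    using grid_half[OF l(1) i(1), THEN of_nat_mono[where 'a=real]]
      grid_half[OF l(2) i(2), THEN of_nat_mono[where 'a=real]]
      of_nat_0_le_iff[of "grid l i", where 'a=real] of_nat_0_le_iff[of "grid l' i'", where 'a=real]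
    unfolding of_nat_mult of_nat_numeral by (intro abs_leI) linarith+
  then have half: "2 * ?d \<le> p" by simp
  have "\<bar>vec_inner N (column l i) (column l' i')\<bar>
      = amplitude\<^sup>2 * \<bar>vec_inner N (\<lambda>j. dft_design p j (grid l i)) (\<lambda>j. dft_design p j (grid l' i'))\<bar>"
    by (simp add: column_def vec_inner_simps abs_mult power2_eq_square)
  also have "\<dots> \<le> amplitude\<^sup>2 * (1 / (2 * ?d))"
    using dD gD half p_pos by (intro mult_left_mono dft_design_correlation) auto
  also have "\<dots> \<le> amplitude\<^sup>2 * (1 / (2 * (g * D)))"
    using dD gD by (intro mult_left_mono frac_le) simp_all
  also have "\<dots> = corr / D"
    by (simp add: amplitude_sq corr_def)
  finally show ?thesis .
qed

text \<open>
  Summing \<open>corr / (m |l - l'|)\<close> over \<open>l'\<close> and then over \<open>l\<close> bounds the total correlation of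
  different blocks.
\<close>

sublocale block_family N s m column "r * ln p" corr "s * (corr / m * (2 * harm s))"
proof
  show "0 < m" "0 \<le> corr" using pos corr_nonneg by auto
next
  fix l i
  have "vec_inner N (column l i) (column l i) = amplitude\<^sup>2 * (N / p)"
    using p_pos by (simp add: column_def vec_inner_simps dft_design_energy power2_eq_square)
  then show "vec_inner N (column l i) (column l i) = r * ln p"
    using pos p_pos by (simp add: amplitude_sq)
next
  fix l i j assume "l \<in> {1..s}" "i < m" "j < m" "i \<noteq> j"
  then show "vec_inner N (column l i) (column l j) \<le> corr / \<bar>real i - real j\<bar>"
    using column_inner[of l l i j "\<bar>real i - real j\<bar>"] by simp
next
  fix \<sigma> \<sigma>' assume \<sigma>: "\<sigma> \<in> {1..s} \<rightarrow>\<^sub>E {..<m}" "\<sigma>' \<in> {1..s} \<rightarrow>\<^sub>E {..<m}"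
  have "(\<Sum>l\<in>{1..s}. \<Sum>l'\<in>{1..s} - {l}. \<bar>vec_inner N (column l (\<sigma> l)) (column l' (\<sigma>' l'))\<bar>)
      \<le> (\<Sum>l\<in>{1..s}. corr / m * (2 * harm s))"
  proof (rule sum_mono)
    fix l assume l: "l \<in> {1..s}"
    have "(\<Sum>l'\<in>{1..s} - {l}. \<bar>vec_inner N (column l (\<sigma> l)) (column l' (\<sigma>' l'))\<bar>)
        \<le> (\<Sum>l'\<in>{1..s} - {l}. corr / m * (1 / \<bar>real l - real l'\<bar>))"
    proof (rule sum_mono)
      fix l' assume l': "l' \<in> {1..s} - {l}"
      have lt: "\<sigma> l < m" "\<sigma>' l' < m" using \<sigma> l l' by (auto simp: PiE_iff)
      have one: "1 \<le> \<bar>real l - real l'\<bar>" using l' by auto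
      have "real m * 1 \<le> real m * \<bar>real l - real l'\<bar>" using one by (intro mult_left_mono) auto
      moreover have "\<bar>real (\<sigma> l) - real (\<sigma>' l')\<bar> \<le> real m"
        using lt by linarith
      moreover have "\<bar>2 * real m * (real l - real l')\<bar> = 2 * (real m * \<bar>real l - real l'\<bar>)"
        by (simp add: abs_mult)
      ultimately have "m * \<bar>real l - real l'\<bar>
          \<le> \<bar>2 * real m * (real l - real l')\<bar> - \<bar>real (\<sigma> l) - real (\<sigma>' l')\<bar>"
        by linarith
      also have "\<dots> \<le> \<bar>2 * real m * (real l - real l') + (real (\<sigma> l) - real (\<sigma>' l'))\<bar>"
        by linarith
      finally have "\<bar>vec_inner N (column l (\<sigma> l)) (column l' (\<sigma>' l'))\<bar>
          \<le> corr / (m * \<bar>real l - real l'\<bar>)"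
        using l l' lt one pos by (intro column_inner) auto
      then show "\<bar>vec_inner N (column l (\<sigma> l)) (column l' (\<sigma>' l'))\<bar>
          \<le> corr / m * (1 / \<bar>real l - real l'\<bar>)" by simp
    qed
    also have "\<dots> = corr / m * (\<Sum>l'\<in>{1..s} - {l}. 1 / \<bar>real l - real l'\<bar>)"
      by (rule sum_distrib_left[symmetric])
    also have "\<dots> \<le> corr / m * (2 * harm s)"
      using l corr_nonneg by (intro mult_left_mono sum_inverse_dist_le_harm) auto
    finally show "(\<Sum>l'\<in>{1..s} - {l}. \<bar>vec_inner N (column l (\<sigma> l)) (column l' (\<sigma>' l'))\<bar>)
        \<le> corr / m * (2 * harm s)" .
  qed
  then show "(\<Sum>l\<in>{1..s}. \<Sum>l'\<in>{1..s} - {l}. \<bar>vec_inner N (column l (\<sigma> l)) (column l' (\<sigma>' l'))\<bar>)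
      \<le> s * (corr / m * (2 * harm s))" by simp
qed

lemma positions_in_param_space:
  assumes \<sigma>: "\<sigma> \<in> choices"
  shows "(positions \<sigma>, amplitudes) \<in> param_space p N s r"
proof -
  have step: "real g \<le> real (grid l' (\<sigma> l')) - real (grid l (\<sigma> l))"
    if l: "l \<in> {1..s}" "l' \<in> {1..s}" "l < l'" for l l'
  proof -
    have lt: "\<sigma> l < m" using choices_less[OF \<sigma> l(1)] .
    have "2 * real m * 1 \<le> 2 * real m * (real l' - real l)"
      using l by (intro mult_left_mono) auto
    then have "real g * 1 \<le> real g * (2 * real m * (real l' - real l) + (real (\<sigma> l') - real (\<sigma> l)))"
      using lt by (intro mult_left_mono) linarith+
    then show ?thesis by (simp only: mult_1_right grid_diff[OF l(2,1)])
  qed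
  have "strict_mono_on {1..s} (positions \<sigma>)"
  proof (rule strict_mono_onI)
    fix l l' assume l: "l \<in> {1..s}" "l' \<in> {1..s}" "l < l'"
    with step[OF l] pos show "positions \<sigma> l < positions \<sigma> l'" by (simp add: positions_def)
  qed
  moreover have "positions \<sigma> \<in> {1..s} \<rightarrow>\<^sub>E {1..p}"
    using grid_half choices_less[OF \<sigma>] by (force simp: positions_def grid_def)
  moreover have "amplitudes \<in> {1..s} \<rightarrow>\<^sub>E UNIV" by (simp add: amplitudes_def)
  moreover have "cmod (amplitudes l) = sqrt (r * p * ln p / N)" if "l \<in> {1..s}" for l
    using that p_pos pos by (simp add: amplitudes_def amplitude_def)
  moreover have "(ln (real N))\<^sup>2 / N \<le> min_separation p s (positions \<sigma>)"
  proof -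
    have gap: "real g \<le> \<bar>real (if l = s then positions \<sigma> 1 + p else positions \<sigma> (l + 1))
        - real (positions \<sigma> l)\<bar>" if l: "l \<in> {1..s}" for l
    proof (cases "l = s")
      case True
      have "4 * 1 * 1 * g \<le> 4 * m * s * g" using pos by (intro mult_le_mono) auto
      then have "4 * g \<le> p" using room by linarith
      moreover have "2 * positions \<sigma> s \<le> p"
        using grid_half[of s "\<sigma> s"] choices_less[OF \<sigma>, of s] pos by (simp add: positions_def)
      ultimately show ?thesis using True by simp
    next
      case False
      then have "l \<in> {1..s}" "l + 1 \<in> {1..s}" using l by auto
      from step[OF this] this False show ?thesis by (simp add: positions_def)
    qed
    have "real g \<le> Min ((\<lambda>l. \<bar>real (if l = s then positions \<sigma> 1 + p else positions \<sigma> (l + 1))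
        - real (positions \<sigma> l)\<bar>) ` {1..s})"
      using gap pos by (subst Min_ge_iff) auto
    then have "g / p \<le> min_separation p s (positions \<sigma>)"
      unfolding min_separation_def by (intro divide_right_mono) auto
    then show ?thesis using separated by linarith
  qed
  ultimately show ?thesis by (simp add: param_space_def)
qed

lemma obs_law_positions:
  assumes \<sigma>: "\<sigma> \<in> choices"
  shows "obs_law p N (coeff_vec s (positions \<sigma>) amplitudes) = density (noise N) (\<lambda>z. ennreal (lr \<sigma> z))"
proof -
  have range: "positions \<sigma> ` {1..s} \<subseteq> {1..p}"
    using positions_in_param_space[OF \<sigma>] by (auto simp: param_space_def)
  have "(\<Sum>k = 1..p. dft_design p j k * coeff_vec s (positions \<sigma>) amplitudes k) = mean \<sigma> j" for j
  proof -
    have "(\<Sum>k = 1..p. dft_design p j k * coeff_vec s (positions \<sigma>) amplitudes k)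
      = (\<Sum>k\<in>{1..p}. \<Sum>l | l \<in> {1..s} \<and> positions \<sigma> l = k. dft_design p j (positions \<sigma> l) * amplitudes l)"
      unfolding coeff_vec_def sum_distrib_left by (intro sum.cong refl) auto
    also have "\<dots> = (\<Sum>l\<in>{1..s}. dft_design p j (positions \<sigma> l) * amplitudes l)"
      using range by (intro sum.group) auto
    also have "\<dots> = mean \<sigma> j"
      unfolding partial_mean_def
      by (intro sum.cong refl) (simp add: positions_def amplitudes_def column_def scaleR_conv_of_real)
    finally show ?thesis .
  qed
  then show ?thesis
    unfolding obs_law_def lr_def by (simp only: distr_noise_shift)
qed

lemma measure_obs_law_positions:
  assumes \<sigma>: "\<sigma> \<in> choices" and [measurable]: "A \<in> sets (obs_space N)"
  shows "measure (obs_law p N (coeff_vec s (positions \<sigma>) amplitudes)) A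
    = (\<integral>z. indicator A z * lr \<sigma> z \<partial>noise N)"
proof -
  have "measure (obs_law p N (coeff_vec s (positions \<sigma>) amplitudes)) A
      = enn2real (\<integral>\<^sup>+z. ennreal (lr \<sigma> z) * indicator A z \<partial>noise N)"
    unfolding obs_law_positions[OF \<sigma>] measure_def by (subst emeasure_density) simp_all
  also have "(\<integral>\<^sup>+z. ennreal (lr \<sigma> z) * indicator A z \<partial>noise N)
      = (\<integral>\<^sup>+z. ennreal (indicator A z * lr \<sigma> z) \<partial>noise N)"
    by (intro nn_integral_cong) (simp split: split_indicator)
  also have "enn2real \<dots> = (\<integral>z. indicator A z * lr \<sigma> z \<partial>noise N)"
    by (subst integral_eq_nn_integral) (auto simp: lr_pos less_imp_le)
  finally show ?thesis .
qed

end

lemma obs_law_zero: "obs_law p N (\<lambda>_. 0) = noise N"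
proof -
  have "vec_inner N (\<lambda>_. 0) z = 0" for z
    by (simp add: vec_inner_def)
  then have "obs_law p N (\<lambda>_. 0) = density (noise N) (\<lambda>_. 1)"
    using distr_noise_shift[of N "\<lambda>_. 0"]
    by (simp only: obs_law_def mult_zero_right sum.neutral_const diff_0_right exp_zero ennreal_1)
  then show ?thesis by (simp only: density_1)
qed

lemma prob_space_obs_law: "prob_space (obs_law p N \<beta>)"
  unfolding obs_law_def
  by (rule prob_space.prob_space_distr[OF prob_space_noise]) (simp add: obs_space_def noise_def)

lemma sets_obs_law [simp]: "sets (obs_law p N \<beta>) = sets (obs_space N)"
  by (simp add: obs_law_def)

lemma bdd_above_acceptance:
  "bdd_above ((\<lambda>(\<tau>, b). measure (obs_law p N (coeff_vec s \<tau> b)) A) ` P)"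
proof (rule bdd_aboveI[of _ 1])
  fix x assume "x \<in> (\<lambda>(\<tau>, b). measure (obs_law p N (coeff_vec s \<tau> b)) A) ` P"
  then obtain \<tau> b where "x = measure (obs_law p N (coeff_vec s \<tau> b)) A" by auto
  then show "x \<le> 1" using prob_space.prob_le_1[OF prob_space_obs_law] by simp
qed

context block_prior
begin

text \<open>
  The supremum over the parameter space dominates the average over the prior.
\<close>

lemma worst_case_risk_lower_bound:
  fixes v1 v2 T \<eta> \<kappa> :: real
  assumes "0 \<le> v1" "0 \<le> v2" and R: "R \<in> sets (obs_space N)"
  defines "\<eta> \<equiv> s * (corr / m * (2 * harm s))"
    and "\<kappa> \<equiv> (2 - 4 * v2 + v2\<^sup>2) * (r * ln p) + 2 * v2 * T"
  shows "1 - sqrt (2 * (s * exp (2 * v1 * (r * ln p) + v1\<^sup>2 * (r * ln p) - 2 * v1 * T + 2 * v1 * \<eta>))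
        + (exp ((2 + 4 * v2 + v2\<^sup>2) * \<eta> + s * (exp \<kappa> + 4 * corr * exp (2 * corr) * harm m) / m) - 1))
    \<le> worst_case_risk p N s r R"
proof -
  let ?A = "space (obs_space N) - R"
  let ?S = "SUP (\<tau>, b)\<in>param_space p N s r. measure (obs_law p N (coeff_vec s \<tau> b)) ?A"
  have A: "?A \<in> sets (obs_space N)" using R by auto
  have "(\<Sum>\<sigma>\<in>choices. \<integral>z. indicator ?A z * lr \<sigma> z \<partial>noise N) \<le> card choices * ?S"
  proof (rule sum_bounded_above)
    fix \<sigma> assume \<sigma>: "\<sigma> \<in> choices"
    show "(\<integral>z. indicator ?A z * lr \<sigma> z \<partial>noise N) \<le> ?S"
      using cSUP_upper[OF positions_in_param_space[OF \<sigma>] bdd_above_acceptance[of p N s ?A]]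
      by (simp add: measure_obs_law_positions[OF \<sigma> A])
  qed
  then have "(\<Sum>\<sigma>\<in>choices. \<integral>z. indicator ?A z * lr \<sigma> z \<partial>noise N) / card choices \<le> ?S"
    using card_choices_pos by (subst pos_divide_le_eq) (auto simp: mult.commute)
  then show ?thesis
    using mixture_risk_bound[OF assms(1-3) refl, of T]
    unfolding worst_case_risk_def obs_law_zero \<eta>_def \<kappa>_def by linarith
qed

lemma param_space_nonempty: "param_space p N s r \<noteq> {}"
proof -
  obtain \<sigma> where "\<sigma> \<in> choices"
    using card_choices_pos by (metis card_gt_0_iff ex_in_conv)
  from positions_in_param_space[OF this] show ?thesis by auto
qed

end

lemma worst_case_risk_nonneg:
  assumes "param_space p N s r \<noteq> {}"
  shows "0 \<le> worst_case_risk p N s r R"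
proof -
  from assms obtain \<tau> b where t: "(\<tau>, b) \<in> param_space p N s r" by auto
  have "0 \<le> measure (obs_law p N (coeff_vec s \<tau> b)) (space (obs_space N) - R)" by simp
  also have "\<dots> \<le> (SUP (\<tau>, b)\<in>param_space p N s r.
        measure (obs_law p N (coeff_vec s \<tau> b)) (space (obs_space N) - R))"
    using cSUP_upper[OF t bdd_above_acceptance[of p N s "space (obs_space N) - R"]] by simp
  finally show ?thesis by (simp add: worst_case_risk_def)
qed

lemma worst_case_risk_empty:
  assumes "param_space p N s r \<noteq> {}"
  shows "worst_case_risk p N s r {} = 1"
proof -
  have "measure (obs_law p N \<beta>) (space (obs_space N)) = 1" for \<beta>
    using prob_space.prob_space[OF prob_space_obs_law[of p N \<beta>]]
    by (simp add: sets_eq_imp_space_eq[OF sets_obs_law])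
  then show ?thesis using assms by (simp add: worst_case_risk_def case_prod_unfold)
qed

section \<open>Asymptotics below the detection boundary\<close>

text \<open>
  The optimal Chernoff parameters are \<open>v = a / q - 1\<close> and \<open>w = max 0 (2 - a / q)\<close>.  They turn the two
  conditions into \<open>b\<^sup>2 < (a - q)\<^sup>2\<close> and, for \<open>2 q \<le> a\<close>, \<open>q\<^sup>2 < a\<^sup>2 / 2 - b\<^sup>2\<close>; for \<open>2 q > a\<close> the
  second condition is again \<open>b\<^sup>2 < (a - q)\<^sup>2\<close>.  Since \<open>(a - b)\<^sup>2 - (a\<^sup>2 / 2 - b\<^sup>2) = (a - 2 b)\<^sup>2 / 2\<close>,
  the first condition follows on both branches of the boundary.
\<close>

lemma detection_boundary_exponents:
  fixes a b q :: real
  assumes "0 < q" "0 < b" "b < a"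
    and r: "q\<^sup>2 < (if 2 * b \<le> a then (a - b)\<^sup>2 else a\<^sup>2 / 2 - b\<^sup>2)"
  obtains v w where "0 \<le> v" "0 \<le> w"
    "b\<^sup>2 + (2 * v + v\<^sup>2) * q\<^sup>2 - 2 * v * (q * a) < 0"
    "2 * b\<^sup>2 - a\<^sup>2 + ((2 - 4 * w + w\<^sup>2) * q\<^sup>2 + 2 * w * (q * a)) < 0"
proof -
  have "a\<^sup>2 / 2 - b\<^sup>2 \<le> (a - b)\<^sup>2"
  proof -
    have "0 \<le> (a - 2 * b)\<^sup>2" by simp
    then show ?thesis by (simp add: power2_eq_square algebra_simps)
  qed
  then have "q\<^sup>2 < (a - b)\<^sup>2" using r by (auto split: if_splits)
  then have q: "q < a - b" using assms by (simp add: power2_less_imp_less)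
  then have b: "b\<^sup>2 < (a - q)\<^sup>2" using assms by (intro power_strict_mono) auto
  define v where "v = a / q - 1"
  have vq: "v * q = a - q" using assms by (simp add: v_def field_simps)
  have "(2 * v + v\<^sup>2) * q\<^sup>2 - 2 * v * (q * a) = 2 * (v * q) * q + (v * q)\<^sup>2 - 2 * (v * q) * a"
    by (simp add: power2_eq_square algebra_simps)
  also have "\<dots> = - (a - q)\<^sup>2"
    unfolding vq by (simp add: power2_eq_square algebra_simps)
  finally have 1: "b\<^sup>2 + (2 * v + v\<^sup>2) * q\<^sup>2 - 2 * v * (q * a) < 0" using b by simp
  have v: "0 \<le> v" using q assms by (simp add: v_def)
  show ?thesis
  proof (cases "2 * q \<le> a")
    case True
    have "q\<^sup>2 < a\<^sup>2 / 2 - b\<^sup>2"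
    proof (cases "2 * b \<le> a")
      case b2: True
      have "(2 * q)\<^sup>2 \<le> a\<^sup>2" "(2 * b)\<^sup>2 \<le> a\<^sup>2"
        using True b2 assms by (intro power_mono; simp)+
      moreover have "(2 * q)\<^sup>2 < a\<^sup>2 \<or> (2 * b)\<^sup>2 < a\<^sup>2"
      proof (rule ccontr)
        assume "\<not> ?thesis"
        then have "\<not> 2 * q < a" "\<not> 2 * b < a"
          using assms power_strict_mono[of "2 * q" a 2] power_strict_mono[of "2 * b" a 2] by auto
        \<comment> \<open>Both \<open>q \<ge> a / 2\<close> and \<open>b \<ge> a / 2\<close> would contradict \<open>q < a - b\<close>.\<close>
        with q show False by simp
      qed
      ultimately show ?thesis by (auto simp: power_mult_distrib)
    qed (use r in auto)
    then show ?thesis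
      using that[OF v _ 1, of 0] by simp
  next
    case False
    define w where "w = 2 - a / q"
    have wq: "w * q = 2 * q - a" using assms by (simp add: w_def field_simps)
    have "(2 - 4 * w + w\<^sup>2) * q\<^sup>2 + 2 * w * (q * a) = 2 * q\<^sup>2 - 4 * (w * q) * q + (w * q)\<^sup>2 + 2 * (w * q) * a"
      by (simp add: power2_eq_square algebra_simps)
    also have "\<dots> = a\<^sup>2 - 2 * (a - q)\<^sup>2"
      unfolding wq by (simp add: power2_eq_square algebra_simps)
    finally have "2 * b\<^sup>2 - a\<^sup>2 + ((2 - 4 * w + w\<^sup>2) * q\<^sup>2 + 2 * w * (q * a)) < 0"
      using b by simp
    moreover have "0 \<le> w" using False assms by (simp add: w_def field_simps)
    ultimately show ?thesis using that v 1 by blast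
  qed
qed

text \<open>
  An upper bound for \<open>s / m\<close>, the expected number of blocks on which two draws agree, as a function
  of the problem size \<open>x = p\<close>.  The exponent will be \<open>\<delta> = 2 \<alpha> - 1 - \<gamma> > 0\<close>.
\<close>

definition block_ratio :: "real \<Rightarrow> real \<Rightarrow> real" where
  "block_ratio \<delta> x = 128 * x powr (- \<delta>) * (ln x)\<^sup>2"

text \<open>
  The error term of the risk bound with \<open>s / m\<close> and the total correlation \<open>\<eta>\<close> replaced by their
  upper bounds.
\<close>

definition risk_defect :: "real \<Rightarrow> real \<Rightarrow> real \<Rightarrow> real \<Rightarrow> real \<Rightarrow> real \<Rightarrow> real \<Rightarrow> real" where
  "risk_defect \<delta> e \<kappa> v C B x =
     (let R = block_ratio \<delta> x in
      sqrt (2 * (2 * x powr (- e) * exp (2 * v * (2 * (R * (1 + ln x)))))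
        + (exp (C * (2 * (R * (1 + ln x))) + (R * x powr \<kappa> + B * (R * (1 + ln x)))) - 1)))"

lemma risk_defect_tendsto_0:
  assumes "0 < \<delta>" "0 < e" "\<kappa> < \<delta>"
  shows "(risk_defect \<delta> e \<kappa> v C B \<longlongrightarrow> 0) at_top"
proof -
  have 1: "((\<lambda>x. block_ratio \<delta> x * (1 + ln x)) \<longlongrightarrow> 0) at_top"
    unfolding block_ratio_def using assms by real_asymp
  have 2: "((\<lambda>x. block_ratio \<delta> x * x powr \<kappa>) \<longlongrightarrow> 0) at_top"
  proof -
    have "((\<lambda>x. 128 * x powr (- (\<delta> - \<kappa>)) * (ln x)\<^sup>2) \<longlongrightarrow> 0) at_top"
      using assms by real_asymp
    moreover have "128 * x powr (- (\<delta> - \<kappa>)) * (ln x)\<^sup>2 = block_ratio \<delta> x * x powr \<kappa>" for x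
      by (simp add: block_ratio_def powr_add[symmetric])
    ultimately show ?thesis by simp
  qed
  have 3: "((\<lambda>x. x powr (- e)) \<longlongrightarrow> 0) at_top"
    using assms by real_asymp
  have "((\<lambda>x. risk_defect \<delta> e \<kappa> v C B x) \<longlongrightarrow>
      sqrt (2 * (2 * 0 * exp (2 * v * (2 * 0))) + (exp (C * (2 * 0) + (0 + B * 0)) - 1))) at_top"
    unfolding risk_defect_def Let_def by (intro tendsto_intros 1 2 3)
  then show ?thesis by simp
qed

text \<open>
  Here \<open>g\<close> is \<open>p (log p)\<^sup>2 / N\<close> rounded up, and \<open>m\<close> is the largest block length that fits.  The
  two logarithms in \<open>g\<close> make neighbouring grid points separated as the parameter space demands, and
  their correlation tends to \<open>0\<close>.  The blocks are long because \<open>\<alpha> > \<gamma>\<close> gives \<open>N / s\<close> a positive power of \<open>p\<close>.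
\<close>

lemma
  fixes p N s :: "nat \<Rightarrow> nat" and \<gamma> \<alpha> r :: real
  assumes \<gamma>: "0 \<le> \<gamma>" "\<gamma> < 1" and \<alpha>: "(1 + \<gamma>) / 2 < \<alpha>" "\<alpha> < 1"
    and N: "filterlim N at_top sequentially"
    and Np: "\<And>n. \<bar>real (N n) - real (p n) powr (1 - \<gamma>)\<bar> < 1"
    and sp: "\<And>n. \<bar>real (s n) - real (p n) powr (1 - \<alpha>)\<bar> < 1"
    and r: "0 < r"
  shows filterlim_problem_size: "filterlim (\<lambda>n. real (p n)) at_top sequentially"
    and eventually_block_prior:
      "\<forall>\<^sub>F n in sequentially. \<exists>m g. block_prior (p n) (N n) (s n) m g r \<and> m \<le> p n \<and> s n \<le> p n
      \<and> 1 < p n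
      \<and> real (s n) / m \<le> block_ratio (2 * \<alpha> - 1 - \<gamma>) (p n)
      \<and> real (s n) \<le> 2 * real (p n) powr (1 - \<alpha>)
      \<and> r * p n * ln (p n) / (2 * N n * g) \<le> 1"
proof -
  have le: "N n \<le> p n" for n
  proof (cases "p n = 0")
    case True
    then show ?thesis using Np[of n] by simp
  next
    case False
    then have "real (p n) powr (1 - \<gamma>) \<le> real (p n) powr 1"
      using \<gamma> by (intro powr_mono) auto
    then have "real (N n) < real (p n) + 1" using Np[of n] False by simp
    then show ?thesis by linarith
  qed
  have "filterlim p at_top sequentially"
    by (rule filterlim_at_top_mono[OF N]) (use le in auto)
  then show P: "filterlim (\<lambda>n. real (p n)) at_top sequentially"
    by (rule filterlim_compose[OF filterlim_real_sequentially])
  note ev = eventually_compose_filterlim[OF _ P]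
  have 1: "\<forall>\<^sub>F x in at_top. 2 \<le> x powr (1 - \<gamma>)" using \<gamma> by real_asymp
  have 2: "\<forall>\<^sub>F x in at_top. 1 < x powr (1 - \<alpha>)" using \<alpha> by real_asymp
  have 3: "\<forall>\<^sub>F x in at_top. 2 \<le> x powr (\<alpha> - \<gamma>) / (32 * (ln x)\<^sup>2)"
  proof -
    have "0 < \<alpha> - \<gamma>" using \<gamma>(2) \<alpha>(1) by (simp add: field_simps)
    then show ?thesis by real_asymp
  qed
  have 4: "\<forall>\<^sub>F x in at_top. (1::real) \<le> ln x" "\<forall>\<^sub>F x in at_top. r \<le> ln x" "\<forall>\<^sub>F x in at_top. (1::real) < x"
    by real_asymp+
  show "\<forall>\<^sub>F n in sequentially. \<exists>m g. block_prior (p n) (N n) (s n) m g r \<and> m \<le> p n \<and> s n \<le> p n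
      \<and> 1 < p n
      \<and> real (s n) / m \<le> block_ratio (2 * \<alpha> - 1 - \<gamma>) (p n)
      \<and> real (s n) \<le> 2 * real (p n) powr (1 - \<alpha>)
      \<and> r * p n * ln (p n) / (2 * N n * g) \<le> 1"
    using ev[OF 1] ev[OF 2] ev[OF 3] ev[OF 4(1)] ev[OF 4(2)] ev[OF 4(3)]
  proof eventually_elim
    case (elim n)
    define x L where "x = real (p n)" and "L = ln x"
    have x: "1 < x" "1 \<le> L" "r \<le> L" using elim by (auto simp: x_def L_def)
    have Nlo: "x powr (1 - \<gamma>) / 2 \<le> N n" and N1: "1 \<le> N n"
      using Np[of n] elim(1) by (auto simp: x_def[symmetric])
    have Nx: "N n \<le> x" using le[of n] by (simp add: x_def)
    have s2: "s n \<le> 2 * x powr (1 - \<alpha>)" and s1: "1 \<le> s n"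
      using sp[of n] elim(2) by (auto simp: x_def[symmetric])
    define g where "g = nat \<lceil>x * L\<^sup>2 / N n\<rceil>"
    have q1: "1 \<le> x * L\<^sup>2 / N n"
    proof -
      have "1 * N n \<le> x * L\<^sup>2"
        using x Nx mult_mono[of "N n" x 1 "L\<^sup>2"] by (simp add: mult.commute one_le_power)
      then show ?thesis using N1 by (simp add: pos_le_divide_eq)
    qed
    have glo: "x * L\<^sup>2 / N n \<le> g" and ghi: "g \<le> 2 * (x * L\<^sup>2 / N n)"
    proof -
      have "y \<le> real (nat \<lceil>y\<rceil>) \<and> real (nat \<lceil>y\<rceil>) \<le> 2 * y" if "1 \<le> y" for y :: real
      proof -
        have "real (nat \<lceil>y\<rceil>) = of_int \<lceil>y\<rceil>" using that by simp
        then show ?thesis using that ceiling_correct[of y] by linarith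
      qed
      from this[OF q1] show "x * L\<^sup>2 / N n \<le> g" "g \<le> 2 * (x * L\<^sup>2 / N n)"
        unfolding g_def by blast+
    qed
    have g1: "1 \<le> g" using glo q1 by linarith
    define m where "m = p n div (4 * s n * g)"
    have den: "0 < real (4 * s n * g)" using g1 s1 by simp
    have "N n / (8 * s n * L\<^sup>2) = x / (4 * s n * (2 * (x * L\<^sup>2 / N n)))"
      using x N1 s1 by (simp add: field_simps)
    also have "\<dots> \<le> x / real (4 * s n * g)"
    proof (rule divide_left_mono)
      have "4 * s n * real g \<le> 4 * s n * (2 * (x * L\<^sup>2 / N n))"
        using ghi by (intro mult_left_mono) auto
      then show le: "real (4 * s n * g) \<le> 4 * s n * (2 * (x * L\<^sup>2 / N n))" by simp
      show "0 < 4 * s n * (2 * (x * L\<^sup>2 / N n)) * real (4 * s n * g)"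
        by (rule mult_pos_pos[OF less_le_trans[OF den le] den])
    qed (use x in auto)
    finally have ratio: "N n / (8 * s n * L\<^sup>2) \<le> x / real (4 * s n * g)" .
    have "2 \<le> x powr (\<alpha> - \<gamma>) / (32 * L\<^sup>2)" using elim by (simp add: x_def L_def)
    also have "\<dots> = (x powr (1 - \<gamma>) / 2) / (8 * (2 * x powr (1 - \<alpha>)) * L\<^sup>2)"
    proof -
      have "x powr (1 - \<gamma>) = x powr (\<alpha> - \<gamma>) * x powr (1 - \<alpha>)"
        by (simp add: powr_add[symmetric])
      then show ?thesis using x by simp
    qed
    also have "\<dots> \<le> N n / (8 * s n * L\<^sup>2)"
      using Nlo s2 s1 x by (intro frac_le mult_right_mono mult_left_mono) auto
    finally have two: "2 \<le> N n / (8 * s n * L\<^sup>2)" .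
    have "x / real (4 * s n * g) < real m + 1"
      using floor_divide_of_nat_eq[of "p n" "4 * s n * g", where 'a=real]
        real_of_int_floor_add_one_gt[of "x / real (4 * s n * g)"]
      unfolding m_def x_def by simp
    then have mlo: "N n / (16 * s n * L\<^sup>2) \<le> m" and m1: "1 \<le> m"
      using ratio two by auto
    have "real (s n) / m \<le> s n / (N n / (16 * s n * L\<^sup>2))"
      using mlo m1 N1 s1 x by (intro divide_left_mono mult_pos_pos divide_pos_pos) auto
    also have "\<dots> = 16 * (real (s n))\<^sup>2 * L\<^sup>2 / N n"
      by (simp add: power2_eq_square)
    also have "\<dots> \<le> 16 * (2 * x powr (1 - \<alpha>))\<^sup>2 * L\<^sup>2 / (x powr (1 - \<gamma>) / 2)"
      using s2 Nlo x by (intro frac_le mult_right_mono mult_left_mono power_mono) auto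
    also have "\<dots> = block_ratio (2 * \<alpha> - 1 - \<gamma>) x"
    proof -
      have "- (2 * \<alpha> - 1 - \<gamma>) = (1 - \<alpha>) + (1 - \<alpha>) - (1 - \<gamma>)" by simp
      then have "x powr (- (2 * \<alpha> - 1 - \<gamma>)) = (x powr (1 - \<alpha>))\<^sup>2 / x powr (1 - \<gamma>)"
        by (simp only: powr_diff powr_add power2_eq_square)
      then show ?thesis by (simp add: block_ratio_def L_def power_mult_distrib)
    qed
    finally have sm: "real (s n) / m \<le> block_ratio (2 * \<alpha> - 1 - \<gamma>) (p n)" by (simp add: x_def)
    have room: "4 * m * s n * g \<le> p n"
      using div_times_less_eq_dividend[of "p n" "4 * s n * g"] by (simp add: m_def mult_ac)
    have "(ln (real (N n)))\<^sup>2 \<le> L\<^sup>2"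
      unfolding L_def using N1 Nx by (intro power_mono) auto
    then have "(ln (real (N n)))\<^sup>2 / N n \<le> (x * L\<^sup>2 / N n) / x"
      using x N1 by (simp add: divide_right_mono)
    also have "\<dots> \<le> g / x" using glo x by (intro divide_right_mono) auto
    finally have sep: "(ln (real (N n)))\<^sup>2 / N n \<le> g / p n" by (simp add: x_def)
    have "block_prior (p n) (N n) (s n) m g r"
      by unfold_locales (use N1 s1 m1 g1 r room sep in auto)
    moreover have "m \<le> p n" by (simp add: m_def)
    moreover have "s n \<le> p n"
    proof -
      have "1 * s n * 1 \<le> (4 * m) * s n * g" using m1 g1 by (intro mult_le_mono) auto
      then show ?thesis using room by linarith
    qed
    moreover have "r * p n * ln (p n) / (2 * N n * g) \<le> 1"
    proof -
      have "r * x * L \<le> L * x * L" using x by (intro mult_right_mono) auto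
      also have "\<dots> = x * L\<^sup>2 / N n * N n" using N1 by (simp add: power2_eq_square)
      also have "\<dots> \<le> real g * real (N n)" using glo by (intro mult_right_mono) auto
      also have "\<dots> \<le> 2 * N n * g" by simp
      finally show ?thesis using N1 g1 by (simp add: x_def L_def)
    qed
    ultimately show ?case using s2 sm x by (auto simp: x_def)
  qed
qed

text \<open>
  The truncation level is \<open>T = a log p\<close>, where \<open>a\<close> stands for the product \<open>q a\<close> of the
  boundary condition, so all exponentials of multiples of \<open>log p\<close> become powers of \<open>p\<close>.
\<close>

lemma (in block_prior) worst_case_risk_rate:
  fixes v w a :: real
  assumes "0 \<le> v" "0 \<le> w" and R: "R \<in> sets (obs_space N)"
    and sizes: "m \<le> p" "s \<le> p" "1 < p" and corr: "corr \<le> 1"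
    and ratio: "real s / m \<le> block_ratio \<delta> p" and sparse: "real s \<le> 2 * real p powr b"
  shows "1 - risk_defect \<delta> (- (b + (2 * v + v\<^sup>2) * r - 2 * v * a))
      ((2 - 4 * w + w\<^sup>2) * r + 2 * w * a) v (2 + 4 * w + w\<^sup>2) (4 * exp 2) p
    \<le> worst_case_risk p N s r R"
proof -
  define T where "T = a * ln p"
  define \<eta> where "\<eta> = s * (corr / m * (2 * harm s))"
  define \<kappa> where "\<kappa> = (2 - 4 * w + w\<^sup>2) * r + 2 * w * a"
  define D where "D = block_ratio \<delta> p * (1 + ln p)"
  have lnp: "0 \<le> ln (real p)" using sizes by simp
  have R0: "0 \<le> block_ratio \<delta> p" by (simp add: block_ratio_def)
  have harm: "0 \<le> (harm k :: real)" "(harm k :: real) \<le> 1 + ln p" if "1 \<le> k" "k \<le> p" for k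
    using harm_le_one_plus_ln[OF that(1)] that by (auto simp: harm_nonneg intro: order_trans)
  note hs = harm[OF pos(2) sizes(2)] and hm = harm[OF pos(3) sizes(1)]
  have "\<eta> = corr * (real s / m * (2 * harm s))" by (simp add: \<eta>_def)
  also have "\<dots> \<le> 1 * (block_ratio \<delta> p * (2 * (1 + ln p)))"
    using corr corr_nonneg ratio hs R0 lnp by (intro mult_mono) auto
  finally have \<eta>: "\<eta> \<le> 2 * D" by (simp add: D_def algebra_simps)
  have exp_ln: "exp (c * ln p) = real p powr c" for c
    using sizes by (simp add: powr_def)
  have "s * exp (2 * v * (r * ln p) + v\<^sup>2 * (r * ln p) - 2 * v * T + 2 * v * \<eta>)
      \<le> (2 * real p powr b) * exp (((2 * v + v\<^sup>2) * r - 2 * v * a) * ln p + 2 * v * (2 * D))"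
  proof (intro mult_mono)
    have "2 * v * \<eta> \<le> 2 * v * (2 * D)"
      using \<eta> \<open>0 \<le> v\<close> by (intro mult_left_mono) auto
    then show "exp (2 * v * (r * ln p) + v\<^sup>2 * (r * ln p) - 2 * v * T + 2 * v * \<eta>)
        \<le> exp (((2 * v + v\<^sup>2) * r - 2 * v * a) * ln p + 2 * v * (2 * D))"
      by (simp add: T_def algebra_simps)
  qed (use sparse in auto)
  also have "\<dots> = 2 * real p powr (b + (2 * v + v\<^sup>2) * r - 2 * v * a) * exp (2 * v * (2 * D))"
    unfolding exp_add exp_ln add_diff_eq[symmetric] powr_add by simp
  finally have first: "s * exp (2 * v * (r * ln p) + v\<^sup>2 * (r * ln p) - 2 * v * T + 2 * v * \<eta>) \<le> \<dots>" .
  have "(2 - 4 * w + w\<^sup>2) * (r * ln p) + 2 * w * T = \<kappa> * ln p"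
    by (simp add: \<kappa>_def T_def algebra_simps)
  then have \<kappa>: "exp ((2 - 4 * w + w\<^sup>2) * (r * ln p) + 2 * w * T) = real p powr \<kappa>"
    by (simp add: exp_ln)
  have "s * (real p powr \<kappa> + 4 * corr * exp (2 * corr) * harm m) / m
      = real s / m * (real p powr \<kappa> + (4 * corr * exp (2 * corr)) * harm m)" by simp
  also have "\<dots> \<le> block_ratio \<delta> p * (real p powr \<kappa> + (4 * 1 * exp 2) * (1 + ln p))"
    using corr corr_nonneg ratio hm R0 lnp
    by (intro mult_mono add_mono order_refl add_nonneg_nonneg mult_nonneg_nonneg) auto
  also have "\<dots> = block_ratio \<delta> p * real p powr \<kappa> + 4 * exp 2 * D"
    by (simp add: D_def algebra_simps)
  finally have "(2 + 4 * w + w\<^sup>2) * \<eta> + s * (real p powr \<kappa> + 4 * corr * exp (2 * corr) * harm m) / m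
      \<le> (2 + 4 * w + w\<^sup>2) * (2 * D) + (block_ratio \<delta> p * real p powr \<kappa> + 4 * exp 2 * D)"
    using \<eta> \<open>0 \<le> w\<close> by (intro add_mono mult_left_mono) auto
  then have second: "exp ((2 + 4 * w + w\<^sup>2) * \<eta>
        + s * (real p powr \<kappa> + 4 * corr * exp (2 * corr) * harm m) / m)
      \<le> exp ((2 + 4 * w + w\<^sup>2) * (2 * D) + (block_ratio \<delta> p * real p powr \<kappa> + 4 * exp 2 * D))"
    by simp
  have "sqrt (2 * (s * exp (2 * v * (r * ln p) + v\<^sup>2 * (r * ln p) - 2 * v * T + 2 * v * \<eta>))
      + (exp ((2 + 4 * w + w\<^sup>2) * \<eta>
        + s * (real p powr \<kappa> + 4 * corr * exp (2 * corr) * harm m) / m) - 1))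
    \<le> risk_defect \<delta> (- (b + (2 * v + v\<^sup>2) * r - 2 * v * a)) \<kappa> v (2 + 4 * w + w\<^sup>2) (4 * exp 2) p"
    unfolding risk_defect_def Let_def D_def[symmetric]
  proof (intro real_sqrt_le_mono add_mono diff_mono order_refl second)
    show "2 * (s * exp (2 * v * (r * ln p) + v\<^sup>2 * (r * ln p) - 2 * v * T + 2 * v * \<eta>))
        \<le> 2 * (2 * real p powr (- (- (b + (2 * v + v\<^sup>2) * r - 2 * v * a))) * exp (2 * v * (2 * D)))"
      by (rule mult_left_mono) (use first in simp_all)
  qed
  then show ?thesis
    using worst_case_risk_lower_bound[OF assms(1-3), of T]
    unfolding \<eta>_def[symmetric] \<kappa> \<kappa>_def[symmetric] by linarith
qed

theorem theorem2p2:
  fixes p N s :: "nat \<Rightarrow> nat" and \<gamma> \<alpha> r :: real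
  assumes "0 \<le> \<gamma>" "\<gamma> < 1"
    and "(1 + \<gamma>) / 2 < \<alpha>" "\<alpha> < 1"
    and "filterlim N at_top sequentially"
    and "\<And>n. \<bar>real (N n) - real (p n) powr (1 - \<gamma>)\<bar> < 1"
    and "\<And>n. \<bar>real (s n) - real (p n) powr (1 - \<alpha>)\<bar> < 1"
    and "0 < r" "r < detection_boundary \<gamma> \<alpha>"
  shows "(\<forall>R. (\<forall>n. R n \<in> sets (obs_space (N n))) \<longrightarrow>
            1 \<le> liminf (\<lambda>n. ereal (worst_case_risk (p n) (N n) (s n) r (R n)))) \<and>
         (\<lambda>n. INF R\<in>sets (obs_space (N n)). worst_case_risk (p n) (N n) (s n) r R) \<longlonglongrightarrow> 1"
proof -
  define a b q where "a = sqrt (1 - \<gamma>)" and "b = sqrt (1 - \<alpha>)" and "q = sqrt r"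
  have sq: "a\<^sup>2 = 1 - \<gamma>" "b\<^sup>2 = 1 - \<alpha>" "q\<^sup>2 = r"
    using assms by (simp_all add: a_def b_def q_def)
  have abq: "0 < q" "0 < b" "b < a"
    using assms by (auto simp: a_def b_def q_def)
  have "q\<^sup>2 < (if 2 * b \<le> a then (a - b)\<^sup>2 else a\<^sup>2 / 2 - b\<^sup>2)"
  proof -
    \<comment> \<open>The branches of the boundary meet at \<open>a = 2 b\<close>.\<close>
    have "2 * b \<le> a \<longleftrightarrow> (2 * b)\<^sup>2 \<le> a\<^sup>2" using abq power_mono_iff[of "2 * b" a 2] by simp
    also have "\<dots> \<longleftrightarrow> 3/4 + \<gamma>/4 \<le> \<alpha>" by (auto simp: power_mult_distrib sq field_simps)
    finally have iff: "2 * b \<le> a \<longleftrightarrow> 3/4 + \<gamma>/4 \<le> \<alpha>" .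
    show ?thesis
      using assms(9) unfolding iff detection_boundary_def a_def[symmetric] b_def[symmetric] sq
      by (auto simp: field_simps split: if_splits)
  qed
  from detection_boundary_exponents[OF abq this] obtain v w where vw: "0 \<le> v" "0 \<le> w"
    and 1: "1 - \<alpha> + (2 * v + v\<^sup>2) * r - 2 * v * (q * a) < 0"
    and 2: "2 * (1 - \<alpha>) - (1 - \<gamma>) + ((2 - 4 * w + w\<^sup>2) * r + 2 * w * (q * a)) < 0"
    unfolding sq by blast
  define \<epsilon> where "\<epsilon> n = risk_defect (2 * \<alpha> - 1 - \<gamma>) (- (1 - \<alpha> + (2 * v + v\<^sup>2) * r - 2 * v * (q * a)))
      ((2 - 4 * w + w\<^sup>2) * r + 2 * w * (q * a)) v (2 + 4 * w + w\<^sup>2) (4 * exp 2) (p n)" for n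
  have "(\<lambda>n. \<epsilon> n) \<longlonglongrightarrow> 0"
    unfolding \<epsilon>_def using 1 2 assms
    by (intro filterlim_compose[OF risk_defect_tendsto_0 filterlim_problem_size[OF assms(1-8)]]) auto
  from tendsto_diff[OF tendsto_const[of 1] this] have lim: "(\<lambda>n. 1 - \<epsilon> n) \<longlonglongrightarrow> 1" by simp
  have main: "\<forall>\<^sub>F n in sequentially. param_space (p n) (N n) (s n) r \<noteq> {} \<and>
      (\<forall>R\<in>sets (obs_space (N n)). 1 - \<epsilon> n \<le> worst_case_risk (p n) (N n) (s n) r R)"
    using eventually_block_prior[OF assms(1-8)]
  proof eventually_elim
    case (elim n)
    then obtain m g where bp: "block_prior (p n) (N n) (s n) m g r"
      and sizes: "m \<le> p n" "s n \<le> p n" "1 < p n"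
      and ratio: "real (s n) / m \<le> block_ratio (2 * \<alpha> - 1 - \<gamma>) (p n)"
      and sparse: "real (s n) \<le> 2 * real (p n) powr (1 - \<alpha>)"
      and corr: "r * p n * ln (p n) / (2 * N n * g) \<le> 1"
      by blast
    interpret block_prior "p n" "N n" "s n" m g r by (rule bp)
    show ?case
      using param_space_nonempty corr
        worst_case_risk_rate[OF vw _ sizes _ ratio sparse, of _ "q * a"]
      by (auto simp: \<epsilon>_def corr_def)
  qed
  show ?thesis
  proof (intro conjI allI impI)
    fix R assume R: "\<forall>n. R n \<in> sets (obs_space (N n))"
    have "(1::ereal) = liminf (\<lambda>n. ereal (1 - \<epsilon> n))"
      using lim by (intro lim_imp_Liminf[symmetric]) (auto simp: one_ereal_def)
    also have "\<dots> \<le> liminf (\<lambda>n. ereal (worst_case_risk (p n) (N n) (s n) r (R n)))"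
      using main R by (intro Liminf_mono) (auto elim!: eventually_mono)
    finally show "1 \<le> liminf (\<lambda>n. ereal (worst_case_risk (p n) (N n) (s n) r (R n)))" .
  next
    show "(\<lambda>n. INF R\<in>sets (obs_space (N n)). worst_case_risk (p n) (N n) (s n) r R) \<longlonglongrightarrow> 1"
    proof (rule tendsto_sandwich[OF _ _ lim tendsto_const])
      show "\<forall>\<^sub>F n in sequentially. 1 - \<epsilon> n
          \<le> (INF R\<in>sets (obs_space (N n)). worst_case_risk (p n) (N n) (s n) r R)"
        using main
      proof eventually_elim
        case (elim n)
        then show ?case by (intro cINF_greatest) (auto intro: sets.empty_sets)
      qed
      show "\<forall>\<^sub>F n in sequentially.
          (INF R\<in>sets (obs_space (N n)). worst_case_risk (p n) (N n) (s n) r R) \<le> 1"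
        using main
      proof eventually_elim
        case (elim n)
        then have "bdd_below (worst_case_risk (p n) (N n) (s n) r ` sets (obs_space (N n)))"
          by (intro bdd_belowI2[of _ 0] worst_case_risk_nonneg) auto
        from cINF_lower[OF this sets.empty_sets] elim show ?case
          by (simp add: worst_case_risk_empty)
      qed
    qed
  qed
qed

end
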